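(* Let $n\ge1$, $0<R\le+\infty$, let $B_R\subset\mathbb{R}^n$ be the ball centered at zero with radius $R$ (so $B_R=\mathbb{R}^n$ if $R=+\infty$), and let $V$ and $W$ be positive radial $C^1$-functions on $B_R\setminus\{0\}$. Assume that $$\int_0^a\frac{1}{r^{n-1}V(r)}\,dr=+\infty\quad\text{and}\quad\int_0^a r^{n-1}V(r)\,dr<\infty\quad\text{for some }0<a<R .$$ Then the following two statements are equivalent: (1) The ordinary differential equation $$y''(r)+\Big(\frac{n-1}{r}+\frac{V_r(r)}{V(r)}\Big)y'(r)+\frac{W(r)}{V(r)}y(r)=0$$ has a positive solution $\varphi$ on the interval $(0,R]$ (possibly with $\varphi(R)=0$). (2) For all $u\in C_0^\infty(B_R)$, $$\int_{B_R}V(x)|\nabla u(x)|^2dx\ge\int_{B_R}W(x)u^2dx .$$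
   Context: Radial functions on $B_R\setminus\{0\}$ are identified with functions of $r=|x|\in(0,R)$, and $V_r$ denotes the derivative in $r$. In (1), positivity is required on the open interval $(0,R)$, while $\varphi(R)=0$ is allowed; when $R=+\infty$ the interval is $(0,\infty)$. *)

theory Defs
  imports "HOL-Analysis.Analysis"
begin

text \<open>The radius may be infinite: \<open>ball0 \<infinity> = UNIV\<close>.\<close>

definition ball0 :: "ereal \<Rightarrow> 'a::real_normed_vector set" where
  "ball0 R = {x. ereal (norm x) < R}"

text \<open>\<open>C\<^sup>k\<close> on an open set \<open>S\<close> of a finite-dimensional space, through directional
  derivatives; for \<open>k > 0\<close> the notion is only meaningful when \<open>S\<close> is open.\<close>

primrec Ck_on :: "nat \<Rightarrow> 'a::euclidean_space set \<Rightarrow> ('a \<Rightarrow> real) \<Rightarrow> bool" where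
  "Ck_on 0 S f \<longleftrightarrow> continuous_on S f"
| "Ck_on (Suc k) S f \<longleftrightarrow>
     (\<forall>x\<in>S. f differentiable (at x)) \<and>
     (\<forall>h. Ck_on k S (\<lambda>x. frechet_derivative f (at x) h))"

text \<open>\<open>C\<^sub>0\<^sup>\<infinity>(S)\<close>: the functions are represented by their extension by zero to the whole
  space, and the support is the closure of the set where the function is nonzero.\<close>

definition test_functions :: "'a::euclidean_space set \<Rightarrow> ('a \<Rightarrow> real) set" where
  "test_functions S =
     {u. (\<forall>k. Ck_on k UNIV u) \<and> compact (closure {x. u x \<noteq> 0}) \<and> closure {x. u x \<noteq> 0} \<subseteq> S}"

definition gradient :: "('a::real_inner \<Rightarrow> real) \<Rightarrow> 'a \<Rightarrow> 'a" where
  "gradient u x = (THE D. GDERIV u x :> D)"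

text \<open>\<open>v\<close> is the expression of \<open>V\<close> as a function of \<open>r = norm x\<close>. The values \<open>v r\<close> for
  \<open>0 < r < R\<close> are determined by \<open>V\<close>; all other values of \<open>v\<close>, as well as \<open>V 0\<close> and the values
  of \<open>V\<close> outside the ball, are irrelevant.\<close>

definition positive_radial_C1 ::
    "ereal \<Rightarrow> ('a::euclidean_space \<Rightarrow> real) \<Rightarrow> (real \<Rightarrow> real) \<Rightarrow> bool" where
  "positive_radial_C1 R V v \<longleftrightarrow>
     Ck_on 1 (ball0 R - {0}) V \<and>
     (\<forall>x \<in> ball0 R - {0}. 0 < V x) \<and>
     (\<forall>x \<in> ball0 R - {0}. V x = v (norm x))"

text \<open>A positive solution on \<open>(0,R]\<close>. The coefficients are only defined on \<open>(0,R)\<close>, so the equation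
  is required there; at a finite endpoint \<open>R\<close> the solution is required to be continuous, and
  \<open>\<phi> R = 0\<close> is allowed. For \<open>R = \<infinity>\<close> the condition \<open>ereal r \<le> R\<close> just gives \<open>(0,\<infinity>)\<close>.\<close>

definition positive_solution ::
    "nat \<Rightarrow> ereal \<Rightarrow> (real \<Rightarrow> real) \<Rightarrow> (real \<Rightarrow> real) \<Rightarrow> (real \<Rightarrow> real) \<Rightarrow> bool" where
  "positive_solution n R v w \<phi> \<longleftrightarrow>
     continuous_on {r. 0 < r \<and> ereal r \<le> R} \<phi> \<and>
     (\<forall>r. 0 < r \<and> ereal r < R \<longrightarrow> 0 < \<phi> r) \<and>
     (\<exists>\<phi>' \<phi>''. \<forall>r. 0 < r \<and> ereal r < R \<longrightarrow>
        (\<phi> has_real_derivative \<phi>' r) (at r) \<and>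
        (\<phi>' has_real_derivative \<phi>'' r) (at r) \<and>
        \<phi>'' r + ((real n - 1) / r + deriv v r / v r) * \<phi>' r + w r / v r * \<phi> r = 0)"

end

theory Submission
  imports Defs "HOL-Computational_Algebra.Polynomial" "HOL-Analysis.Analysis"
begin

text \<open>With \<open>P r = r\<^sup>n\<^sup>-\<^sup>1 v r\<close> and \<open>Q r = r\<^sup>n\<^sup>-\<^sup>1 w r\<close> the equation is the Sturm--Liouville system
  \<open>y' = z / P\<close>, \<open>z' = - Q y\<close>. For a positive solution \<open>z\<close> decreases; since \<open>1 / P\<close> is not integrable
  at \<open>0\<close>, this forces \<open>z \<le> 0\<close>. Hence, along every ray, the identity
  \<open>P f'\<^sup>2 - Q f\<^sup>2 = ((z / y) f\<^sup>2)' + P (f' - z / (P y) f)\<^sup>2\<close> integrates to the one-dimensional inequality with a boundary term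
  of the right sign, and polar coordinates give (2); also \<open>y\<close> is decreasing, so it extends continuously to \<open>R\<close>.

  Conversely, (2) for radial functions makes the form \<open>\<integral> P f'\<^sup>2 - Q f\<^sup>2\<close> nonnegative on \<open>C\<^sup>1\<close>
  functions with compact support in \<open>(0, R)\<close>. A nontrivial solution with two zeros would be a null vector of the form that
  is not in its kernel, so solutions have at most one zero, and the extremal solution
  \<open>y\<^sub>0 + s y\<^sub>1\<close> with \<open>s = sup (- y\<^sub>0 / y\<^sub>1)\<close> over \<open>r > c\<close> is positive.\<close>

text \<open>Two gaps shape the proof. In (2), \<open>u\<close> is unrestricted at the origin, where
  the weights may be singular. Integrals are therefore taken in [0,\<infinity>], and integration by
  parts happens only on compact intervals \<open>{l..h}\<close>, with \<open>l\<close> sent to 0 by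
  monotone convergence; neither side of (2) has to be shown finite. In the converse, the natural
  null vector, a solution cut off at two of its zeros, has corners, whereas (2) only speaks of
  smooth functions. That gap is closed in two stages: from smooth to C^1 by writing a C^1 profile as
  g(r^2) times a fixed smooth bump and approximating g and its derivative by polynomials, and from
  C^1 to corners by flattening the solution near its zeros. No minimizer of the form is sought
  either: perturbing the approximate null vector to first order already makes the form
  negative.\<close>

subsection \<open>Calculus on the line\<close>

text \<open>In the norm weighted by \<open>exp (2 * K * \<bar>r - c\<bar>)\<close> one Picard step halves the bound, so the
  Picard series below converges geometrically on any compact interval.\<close>

lemma exp_bound_step:
  fixes F F' :: "real \<Rightarrow> real"
  assumes F: "\<And>t. t \<in> {l..h} \<Longrightarrow> (F has_real_derivative F' t) (at t)"
    and bd: "\<And>t. t \<in> {l..h} \<Longrightarrow> \<bar>F' t\<bar> \<le> K * (M * exp (2 * K * \<bar>t - c\<bar>))"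
    and "c \<in> {l..h}" "r \<in> {l..h}" "F c = 0" "0 < K" "0 \<le> M"
  shows "\<bar>F r\<bar> \<le> M / 2 * exp (2 * K * \<bar>r - c\<bar>)"
proof -
  have cont: "continuous_on {l..h} F"
    using F by (meson DERIV_continuous_on has_field_derivative_at_within)
  consider "r = c" | "c < r" | "r < c" by linarith
  then show ?thesis
  proof cases
    case 1 then show ?thesis using assms by simp
  next
    case 2
    have "norm (F r - F c) \<le> (\<lambda>t. M / 2 * exp (2 * K * (t - c))) r - (\<lambda>t. M / 2 * exp (2 * K * (t - c))) c"
    proof (rule differentiable_bound_general[OF 2, where f' = F' and \<phi>' = "\<lambda>t. K * (M * exp (2 * K * (t - c)))"])
      show "continuous_on {c..r} F" by (rule continuous_on_subset[OF cont]) (use assms in auto)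
      show "\<And>x. c < x \<Longrightarrow> x < r \<Longrightarrow> (F has_vector_derivative F' x) (at x)"
        using F assms by (auto simp: has_real_derivative_iff_has_vector_derivative[symmetric])
      show "((\<lambda>t. M / 2 * exp (2 * K * (t - c))) has_vector_derivative K * (M * exp (2 * K * (x - c)))) (at x)" for x
        unfolding has_real_derivative_iff_has_vector_derivative[symmetric]
        by (auto intro!: derivative_eq_intros)
      show "norm (F' x) \<le> K * (M * exp (2 * K * (x - c)))" if "c < x" "x < r" for x
        using bd[of x] that assms by auto
    qed (auto intro!: continuous_intros)
    then show ?thesis using 2 assms by auto
  next
    case 3
    \<comment> \<open>Left of \<open>c\<close> the weight decreases, so the increasing comparison
      function is minus the exponential.\<close>
    have "norm (F c - F r) \<le> (\<lambda>t. - M / 2 * exp (2 * K * (c - t))) c - (\<lambda>t. - M / 2 * exp (2 * K * (c - t))) r"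
    proof (rule differentiable_bound_general[OF 3, where f' = F' and \<phi>' = "\<lambda>t. K * (M * exp (2 * K * (c - t)))"])
      show "continuous_on {r..c} F" by (rule continuous_on_subset[OF cont]) (use assms in auto)
      show "\<And>x. r < x \<Longrightarrow> x < c \<Longrightarrow> (F has_vector_derivative F' x) (at x)"
        using F assms by (auto simp: has_real_derivative_iff_has_vector_derivative[symmetric])
      show "((\<lambda>t. - M / 2 * exp (2 * K * (c - t))) has_vector_derivative K * (M * exp (2 * K * (c - x)))) (at x)" for x
        unfolding has_real_derivative_iff_has_vector_derivative[symmetric]
        by (auto intro!: derivative_eq_intros)
      show "norm (F' x) \<le> K * (M * exp (2 * K * (c - x)))" if "r < x" "x < c" for x
        using bd[of x] that assms by auto
    qed (auto intro!: continuous_intros)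
    then show ?thesis using 3 assms by auto
  qed
qed

text \<open>At an endpoint where \<open>h\<close> and \<open>h'\<close> vanish, the difference
  quotients of the truncation are dominated by those of \<open>h\<close>. This is how cut-off
  solutions and polynomial bumps become C^1 on the whole line.\<close>

lemma extend_by_zero:
  fixes h h' :: "real \<Rightarrow> real"
  assumes D: "\<And>r. r \<in> {l..u} \<Longrightarrow> (h has_real_derivative h' r) (at r)" and "l < u"
    and cont: "continuous_on {l..u} h'"
    and 0: "h l = 0" "h u = 0" "h' l = 0" "h' u = 0"
  shows "((\<lambda>r. if r \<in> {l..u} then h r else 0) has_real_derivative (if r \<in> {l..u} then h' r else 0)) (at r)"
      (is "(?H has_real_derivative ?H' r) (at r)")
    and "continuous_on UNIV (\<lambda>r. if r \<in> {l..u} then h' r else 0)"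
proof -
  have squeeze: "(?H has_real_derivative 0) (at x)" if "(h has_real_derivative 0) (at x)" "h x = 0" for x
  proof -
    have "((\<lambda>y. (h y - h x) / (y - x)) \<longlongrightarrow> 0) (at x)"
      using that by (simp add: has_field_derivative_iff)
    then have "((\<lambda>y. (?H y - ?H x) / (y - x)) \<longlongrightarrow> 0) (at x)"
      by (rule Lim_null_comparison[rotated, OF tendsto_norm_zero]) (use that in \<open>auto intro!: always_eventually simp: abs_mult\<close>)
    then show ?thesis by (simp add: has_field_derivative_iff)
  qed
  consider "r < l" | "r = l" | "l < r \<and> r < u" | "r = u" | "u < r" by linarith
  then show "(?H has_real_derivative ?H' r) (at r)"
  proof cases
    case 1
    have "((\<lambda>_. 0) has_real_derivative 0) (at r)" by simp
    then have "(?H has_real_derivative 0) (at r)"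
      by (rule has_field_derivative_transform_within_open[of _ _ _ "{..<l}"]) (use 1 in auto)
    then show ?thesis using 1 by simp
  next
    case 2
    then show ?thesis using squeeze[of l] D[of l] 0 \<open>l < u\<close> by auto
  next
    case 3
    then have "(h has_real_derivative h' r) (at r)" using D by auto
    then have "(?H has_real_derivative h' r) (at r)"
      by (rule has_field_derivative_transform_within_open[of _ _ _ "{l<..<u}"]) (use 3 in auto)
    then show ?thesis using 3 by simp
  next
    case 4
    then show ?thesis using squeeze[of u] D[of u] 0 \<open>l < u\<close> by auto
  next
    case 5
    have "((\<lambda>_. 0) has_real_derivative 0) (at r)" by simp
    then have "(?H has_real_derivative 0) (at r)"
      by (rule has_field_derivative_transform_within_open[of _ _ _ "{u<..}"]) (use 5 in auto)
    then show ?thesis using 5 by simp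
  qed
  \<comment> \<open>Clamping the argument to \<open>{l..u}\<close> has the same effect as cutting
    off, since \<open>h'\<close> vanishes at both ends, and it visibly preserves continuity.\<close>
  have "continuous_on UNIV (\<lambda>r. h' (max l (min u r)))"
    by (rule continuous_on_compose2[OF cont]) (use \<open>l < u\<close> in \<open>auto intro!: continuous_intros\<close>)
  moreover have "h' (max l (min u r)) = ?H' r" for r
    using 0 \<open>l < u\<close> by (auto simp: max_def min_def)
  ultimately show "continuous_on UNIV ?H'" by simp
qed

lemma FTC_real:
  fixes F f :: "real \<Rightarrow> real"
  assumes "l \<le> u" "\<And>x. x \<in> {l..u} \<Longrightarrow> (F has_real_derivative f x) (at x)"
  shows "(f has_integral F u - F l) {l..u}"
  using assms by (intro fundamental_theorem_of_calculus)
    (auto simp: has_real_derivative_iff_has_vector_derivative[symmetric] intro: has_field_derivative_at_within)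

lemma ennreal_indicator_continuous_measurable:
  assumes "S \<in> sets borel" "continuous_on S f"
  shows "(\<lambda>x. ennreal (f x) * indicator S x) \<in> borel_measurable borel"
proof -
  have "(\<lambda>x. indicator S x *\<^sub>R f x) \<in> borel_measurable borel"
    by (rule borel_measurable_continuous_on_indicator[OF assms])
  then have "(\<lambda>x. ennreal (indicator S x *\<^sub>R f x)) \<in> borel_measurable borel" by measurable
  moreover have "ennreal (indicator S x *\<^sub>R f x) = ennreal (f x) * indicator S x" for x
    by (simp split: split_indicator)
  ultimately show ?thesis by simp
qed

text \<open>Monotone convergence along the cut-offs \<open>1 / Suc k\<close>. It reduces integrals
  that are singular at 0 to intervals bounded away from 0, where everything is continuous.\<close>

lemma nn_integral_le_truncated:
  fixes f :: "real \<Rightarrow> ennreal"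
  assumes f [measurable]: "f \<in> borel_measurable borel"
    and le: "\<And>\<epsilon>. 0 < \<epsilon> \<Longrightarrow> (\<integral>\<^sup>+r. f r * indicator {\<epsilon><..} r \<partial>lborel) \<le> C"
  shows "(\<integral>\<^sup>+r. f r * indicator {0<..} r \<partial>lborel) \<le> C"
proof -
  have "f r * indicator {0<..} r = (SUP k. f r * indicator {1 / real (Suc k)<..} r)" for r
  proof (cases "0 < r")
    case True
    then obtain k where k: "1 / real (Suc k) < r" using nat_approx_posE by blast
    show ?thesis
    proof (rule antisym)
      show "f r * indicator {0<..} r \<le> (SUP k. f r * indicator {1 / real (Suc k)<..} r)"
        by (rule SUP_upper2[of k]) (use k True in auto)
      show "(SUP k. f r * indicator {1 / real (Suc k)<..} r) \<le> f r * indicator {0<..} r"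
        by (rule SUP_least) (use True in \<open>auto split: split_indicator\<close>)
    qed
  next
    case False
    have "r \<notin> {1 / real (Suc k)<..}" for k
    proof -
      have "0 < 1 / real (Suc k)" by simp
      then have "\<not> 1 / real (Suc k) < r" using False by linarith
      then show ?thesis by (simp only: greaterThan_iff not_False_eq_True)
    qed
    then show ?thesis using False by simp
  qed
  then have "(\<integral>\<^sup>+r. f r * indicator {0<..} r \<partial>lborel) =
      (\<integral>\<^sup>+r. (SUP k. f r * indicator {1 / real (Suc k)<..} r) \<partial>lborel)" by simp
  also have "\<dots> = (SUP k. (\<integral>\<^sup>+r. f r * indicator {1 / real (Suc k)<..} r \<partial>lborel))"
  proof (rule nn_integral_monotone_convergence_SUP)
    show "incseq (\<lambda>k r. f r * indicator {1 / real (Suc k)<..} r)"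
    proof (intro incseq_SucI le_funI mult_left_mono)
      fix k :: nat and r :: real
      have "1 / real (Suc (Suc k)) \<le> 1 / real (Suc k)" by (intro divide_left_mono) auto
      then show "indicator {1 / real (Suc k)<..} r \<le> (indicator {1 / real (Suc (Suc k))<..} r :: ennreal)"
        by (auto split: split_indicator)
    qed simp
  qed measurable
  also have "\<dots> \<le> C" by (rule SUP_least) (rule le, simp)
  finally show ?thesis .
qed

subsection \<open>Sturm--Liouville systems\<close>

text \<open>The flux \<open>z\<close> = P y' replaces the second derivative, so existence, linearity
  and uniqueness concern a first-order linear system with continuous coefficients. Continuity of
  \<open>P'\<close> is for \<open>disconjugate\<close>, where an integration by parts differentiates
  \<open>P\<close> times the derivative of a bump.\<close>

locale sturm_liouville =
  fixes a b :: ereal and P P' Q :: "real \<Rightarrow> real"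
  assumes P_pos: "r \<in> einterval a b \<Longrightarrow> 0 < P r"
    and P_deriv: "r \<in> einterval a b \<Longrightarrow> (P has_real_derivative P' r) (at r)"
    and P'_cont: "continuous_on (einterval a b) P'"
    and Q_pos: "r \<in> einterval a b \<Longrightarrow> 0 < Q r"
    and Q_cont: "continuous_on (einterval a b) Q"
begin

definition solution :: "(real \<Rightarrow> real) \<Rightarrow> (real \<Rightarrow> real) \<Rightarrow> bool" where
  "solution y z \<longleftrightarrow> (\<forall>r \<in> einterval a b.
     (y has_real_derivative z r / P r) (at r) \<and> (z has_real_derivative - Q r * y r) (at r))"

lemma Icc_subset: "l \<in> einterval a b \<Longrightarrow> h \<in> einterval a b \<Longrightarrow> {l..h} \<subseteq> einterval a b"
  by (auto simp: einterval_def) (metis ereal_less_eq(3) less_le_trans, metis ereal_less_eq(3) le_less_trans)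

lemma P_cont: "continuous_on (einterval a b) P"
  using P_deriv by (meson DERIV_continuous_on has_field_derivative_at_within)

section \<open>Initial value problems: existence, linearity, uniqueness\<close>

lemma antiderivative:
  fixes f :: "real \<Rightarrow> real"
  assumes "continuous_on (einterval a b) f" "c \<in> einterval a b"
  shows "\<exists>F. F c = 0 \<and> (\<forall>r\<in>einterval a b. (F has_real_derivative f r) (at r))"
proof -
  have "a < b" using assms(2) by (auto simp: einterval_def)
  moreover have "\<And>x. a < ereal x \<Longrightarrow> ereal x < b \<Longrightarrow> isCont f x"
    using assms(1) by (simp add: continuous_on_eq_continuous_at einterval_iff)
  ultimately obtain F where F: "\<And>x. a < ereal x \<Longrightarrow> ereal x < b \<Longrightarrow> (F has_vector_derivative f x) (at x)"
    using einterval_antiderivative[of a b f] by blast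
  show ?thesis
    by (rule exI[of _ "\<lambda>x. F x - F c"])
      (auto intro!: derivative_eq_intros F[unfolded has_real_derivative_iff_has_vector_derivative[symmetric]]
        simp: einterval_def)
qed

lemma coeff_bound:
  assumes "l \<in> einterval a b" "h \<in> einterval a b"
  obtains K where "0 < K" "\<And>t. t \<in> {l..h} \<Longrightarrow> 1 / P t \<le> K" "\<And>t. t \<in> {l..h} \<Longrightarrow> Q t \<le> K"
proof -
  have sub: "{l..h} \<subseteq> einterval a b" by (rule Icc_subset[OF assms])
  have "compact ((\<lambda>t. 1 / P t) ` {l..h})"
    by (intro compact_continuous_image continuous_intros continuous_on_subset[OF P_cont sub] compact_Icc)
      (use sub P_pos in \<open>force dest!: subsetD\<close>)
  then obtain K1 where K1: "\<And>t. t \<in> {l..h} \<Longrightarrow> \<bar>1 / P t\<bar> \<le> K1"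
    using compact_imp_bounded bounded_real by (metis imageI)
  have "compact (Q ` {l..h})"
    by (intro compact_continuous_image continuous_intros continuous_on_subset[OF Q_cont sub]) auto
  then obtain K2 where K2: "\<And>t. t \<in> {l..h} \<Longrightarrow> \<bar>Q t\<bar> \<le> K2"
    using compact_imp_bounded bounded_real by (metis imageI)
  show ?thesis
  proof (rule that[of "\<bar>K1\<bar> + \<bar>K2\<bar> + 1"])
    show "1 / P t \<le> \<bar>K1\<bar> + \<bar>K2\<bar> + 1" "Q t \<le> \<bar>K1\<bar> + \<bar>K2\<bar> + 1" if "t \<in> {l..h}" for t
      using K1[OF that] K2[OF that] by linarith+
  qed simp
qed

text \<open>Picard series. On each compact interval around \<open>c\<close> the terms decay like
  2^(-k), by \<open>exp_bound_step\<close>, so the Weierstrass test permits termwise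
  differentiation. The constant \<open>K\<close> depends on the interval but the series does not,
  which makes the solution global at once.\<close>

lemma solution_exists:
  assumes c: "c \<in> einterval a b"
  shows "\<exists>y z. solution y z \<and> y c = A \<and> z c = B"
proof -
  \<comment> \<open>Choosing one antiderivative vanishing at \<open>c\<close> for each integrand
    turns integration from \<open>c\<close> into a function, so that the iteration can be a
    primitive recursion.\<close>
  define AD where "AD f = (SOME F. F c = 0 \<and> (\<forall>r\<in>einterval a b. (F has_real_derivative f r) (at r)))"
    for f :: "real \<Rightarrow> real"
  have AD: "AD f c = 0" "\<And>r. r \<in> einterval a b \<Longrightarrow> (AD f has_real_derivative f r) (at r)"
    if "continuous_on (einterval a b) f" for f
    using someI_ex[OF antiderivative[OF that c]] unfolding AD_def by auto
  \<comment> \<open>These are the increments of the Picard iteration, not the iterates: the initial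
    values enter in term 0 only, and the solution is the sum of all terms.\<close>
  define S where "S = rec_nat (\<lambda>_::real. A, \<lambda>_::real. B)
    (\<lambda>_ p. (AD (\<lambda>r. snd p r / P r), AD (\<lambda>r. - Q r * fst p r)))"
  define Y where "Y k = fst (S k)" for k
  define Z where "Z k = snd (S k)" for k
  have Y0: "Y 0 = (\<lambda>_. A)" "Z 0 = (\<lambda>_. B)" by (simp_all add: Y_def Z_def S_def)
  have YS: "Y (Suc k) = AD (\<lambda>r. Z k r / P r)" "Z (Suc k) = AD (\<lambda>r. - Q r * Y k r)" for k
    by (simp_all add: Y_def Z_def S_def)
  have contD: "continuous_on (einterval a b) f"
    if "\<And>r. r \<in> einterval a b \<Longrightarrow> (f has_real_derivative f' r) (at r)" for f f'
    using that by (meson DERIV_continuous_on has_field_derivative_at_within)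
  have P0: "P r \<noteq> 0" if "r \<in> einterval a b" for r using P_pos[OF that] by simp
  have cont: "continuous_on (einterval a b) (Y k) \<and> continuous_on (einterval a b) (Z k)" for k
  proof (induction k)
    case 0 show ?case by (simp add: Y0)
  next
    case (Suc k)
    have "continuous_on (einterval a b) (\<lambda>r. Z k r / P r)"
      using Suc P_cont P0 by (auto intro!: continuous_intros)
    moreover have "continuous_on (einterval a b) (\<lambda>r. - Q r * Y k r)"
      using Suc Q_cont by (auto intro!: continuous_intros)
    ultimately show ?case
      unfolding YS using AD(2) by (meson contD)
  qed
  have c1: "continuous_on (einterval a b) (\<lambda>r. Z k r / P r)" for k
    using cont P_cont P0 by (auto intro!: continuous_intros)
  have c2: "continuous_on (einterval a b) (\<lambda>r. - Q r * Y k r)" for k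
    using cont Q_cont by (auto intro!: continuous_intros)
  have YD: "(Y (Suc k) has_real_derivative Z k r / P r) (at r)" if "r \<in> einterval a b" for k r
    unfolding YS using AD(2)[OF c1 that] .
  have ZD: "(Z (Suc k) has_real_derivative - Q r * Y k r) (at r)" if "r \<in> einterval a b" for k r
    unfolding YS using AD(2)[OF c2 that] .
  have YZc: "Y (Suc k) c = 0" "Z (Suc k) c = 0" for k
    unfolding YS using AD(1)[OF c1] AD(1)[OF c2] by auto
  define M where "M = \<bar>A\<bar> + \<bar>B\<bar>"
  have bound: "\<bar>Y k r\<bar> \<le> M / 2 ^ k * exp (2 * K * \<bar>r - c\<bar>) \<and> \<bar>Z k r\<bar> \<le> M / 2 ^ k * exp (2 * K * \<bar>r - c\<bar>)"
    if lh: "l \<in> einterval a b" "h \<in> einterval a b" "c \<in> {l..h}" "r \<in> {l..h}"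
      and K: "0 < K" "\<And>t. t \<in> {l..h} \<Longrightarrow> 1 / P t \<le> K" "\<And>t. t \<in> {l..h} \<Longrightarrow> Q t \<le> K"
    for l h K k r
    using lh(4)
  proof (induction k arbitrary: r)
    case 0
    have "1 \<le> exp (2 * K * \<bar>r - c\<bar>)" using K by simp
    moreover have "0 \<le> M" by (simp add: M_def)
    ultimately have "M * 1 \<le> M * exp (2 * K * \<bar>r - c\<bar>)" by (rule mult_left_mono)
    then show ?case by (auto simp: Y0 M_def)
  next
    case (Suc k)
    have sub: "\<And>t. t \<in> {l..h} \<Longrightarrow> t \<in> einterval a b" using Icc_subset[OF lh(1,2)] by auto
    have "\<bar>Y (Suc k) r\<bar> \<le> (M / 2 ^ k) / 2 * exp (2 * K * \<bar>r - c\<bar>)"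
    proof (rule exp_bound_step[OF YD[OF sub]])
      show "\<bar>Z k t / P t\<bar> \<le> K * (M / 2 ^ k * exp (2 * K * \<bar>t - c\<bar>))" if "t \<in> {l..h}" for t
      proof -
        have "\<bar>Z k t / P t\<bar> = 1 / P t * \<bar>Z k t\<bar>" using P_pos[OF sub[OF that]] by (simp add: abs_mult)
        also have "\<dots> \<le> K * (M / 2 ^ k * exp (2 * K * \<bar>t - c\<bar>))"
          using K Suc.IH[OF that] that by (intro mult_mono) auto
        finally show ?thesis .
      qed
    qed (use Suc.prems lh K YZc in \<open>auto simp: M_def\<close>)
    moreover have "\<bar>Z (Suc k) r\<bar> \<le> (M / 2 ^ k) / 2 * exp (2 * K * \<bar>r - c\<bar>)"
    proof (rule exp_bound_step[OF ZD[OF sub]])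
      show "\<bar>- Q t * Y k t\<bar> \<le> K * (M / 2 ^ k * exp (2 * K * \<bar>t - c\<bar>))" if "t \<in> {l..h}" for t
      proof -
        have "\<bar>- Q t * Y k t\<bar> = Q t * \<bar>Y k t\<bar>" using Q_pos[OF sub[OF that]] by (simp add: abs_mult)
        also have "\<dots> \<le> K * (M / 2 ^ k * exp (2 * K * \<bar>t - c\<bar>))"
          using K Suc.IH[OF that] that Q_pos[OF sub[OF that]] by (intro mult_mono) auto
        finally show ?thesis .
      qed
    qed (use Suc.prems lh K YZc in \<open>auto simp: M_def\<close>)
    ultimately show ?case by simp
  qed
  define y where "y r = (\<Sum>k. Y k r)" for r
  define z where "z r = (\<Sum>k. Z k r)" for r
  have "(y has_real_derivative z r / P r) (at r) \<and> (z has_real_derivative - Q r * y r) (at r)"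
    if r: "r \<in> einterval a b" for r
  proof -
    have "open (einterval a b)" by simp
    then obtain e1 where e1: "0 < e1" "cball r e1 \<subseteq> einterval a b"
      using r open_contains_cball by metis
    \<comment> \<open>The interval must contain \<open>c\<close>, where the bounds are anchored, and
      have \<open>r\<close> in its interior, where the series is differentiated.\<close>
    define l where "l = min c (r - e1)"
    define h where "h = max c (r + e1)"
    have lh: "l \<in> einterval a b" "h \<in> einterval a b" "c \<in> {l..h}"
      using e1 c by (auto simp: l_def h_def min_def max_def subset_iff dist_real_def)
    have sub: "\<And>t. t \<in> {l..h} \<Longrightarrow> t \<in> einterval a b" using Icc_subset[OF lh(1,2)] by auto
    have int: "r \<in> interior {l..h}" using e1 by (auto simp: l_def h_def)
    then have rin: "r \<in> {l..h}" using interior_subset by blast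
    obtain K where K: "0 < K" "\<And>t. t \<in> {l..h} \<Longrightarrow> 1 / P t \<le> K" "\<And>t. t \<in> {l..h} \<Longrightarrow> Q t \<le> K"
      using coeff_bound[OF lh(1,2)] by metis
    define C where "C = M * exp (2 * K * (h - l))"
    have bd: "\<bar>Y k t\<bar> \<le> C / 2 ^ k" "\<bar>Z k t\<bar> \<le> C / 2 ^ k" if "t \<in> {l..h}" for k t
    proof -
      have "\<bar>t - c\<bar> \<le> h - l" using that lh by auto
      then have "exp (2 * K * \<bar>t - c\<bar>) \<le> exp (2 * K * (h - l))" using K by simp
      then have "M / 2 ^ k * exp (2 * K * \<bar>t - c\<bar>) \<le> M / 2 ^ k * exp (2 * K * (h - l))"
        by (intro mult_left_mono) (auto simp: M_def)
      then show "\<bar>Y k t\<bar> \<le> C / 2 ^ k" "\<bar>Z k t\<bar> \<le> C / 2 ^ k"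
        using bound[OF lh that K, of k] by (auto simp: C_def)
    qed
    have geo: "summable (\<lambda>k. C / 2 ^ k)"
      using summable_mult[OF summable_geometric[of "1/2::real"], of C] by (simp add: power_divide)
    have sY: "summable (\<lambda>k. Y k t)" and sZ: "summable (\<lambda>k. Z k t)" if "t \<in> {l..h}" for t
      using bd[OF that] by (auto intro!: summable_comparison_test'[OF geo])
    \<comment> \<open>Differentiation shifts the index by one: the constant term 0 contributes 0,
      and the derivative of term \<open>Suc j\<close> is built from term \<open>j\<close> of the
      other series.\<close>
    define Y' where "Y' k t = (case k of 0 \<Rightarrow> 0 | Suc j \<Rightarrow> Z j t / P t)" for k t
    define Z' where "Z' k t = (case k of 0 \<Rightarrow> 0 | Suc j \<Rightarrow> - Q t * Y j t)" for k t
    have C0: "0 \<le> C" by (simp add: C_def M_def)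
    have bd': "\<bar>Y' k t\<bar> \<le> 2 * K * (C / 2 ^ k) \<and> \<bar>Z' k t\<bar> \<le> 2 * K * (C / 2 ^ k)" if "t \<in> {l..h}" for k t
    proof (cases k)
      case 0 then show ?thesis using C0 K by (simp add: Y'_def Z'_def)
    next
      case (Suc j)
      have "\<bar>Z j t / P t\<bar> = 1 / P t * \<bar>Z j t\<bar>" using P_pos[OF sub[OF that]] by (simp add: abs_mult)
      also have "\<dots> \<le> K * (C / 2 ^ j)" using K that bd by (intro mult_mono) auto
      finally have 1: "\<bar>Z j t / P t\<bar> \<le> K * (C / 2 ^ j)" .
      have "\<bar>- Q t * Y j t\<bar> = Q t * \<bar>Y j t\<bar>" using Q_pos[OF sub[OF that]] by (simp add: abs_mult)
      also have "\<dots> \<le> K * (C / 2 ^ j)" using K that bd by (intro mult_mono) auto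
      finally have 2: "\<bar>- Q t * Y j t\<bar> \<le> K * (C / 2 ^ j)" .
      show ?thesis using 1 2 Suc by (simp add: Y'_def Z'_def)
    qed
    have geo': "summable (\<lambda>k. 2 * K * (C / 2 ^ k))" using geo by (rule summable_mult)
    have uY: "uniformly_convergent_on {l..h} (\<lambda>n x. \<Sum>i<n. Y' i x)"
      by (rule Weierstrass_m_test'[OF _ geo']) (use bd' in auto)
    have uZ: "uniformly_convergent_on {l..h} (\<lambda>n x. \<Sum>i<n. Z' i x)"
      by (rule Weierstrass_m_test'[OF _ geo']) (use bd' in auto)
    have dY: "(Y k has_real_derivative Y' k t) (at t within {l..h})" if "t \<in> {l..h}" for k t
      by (cases k) (use YD[OF sub[OF that]] in \<open>auto simp: Y'_def Y0 intro: has_field_derivative_at_within\<close>)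
    have dZ: "(Z k has_real_derivative Z' k t) (at t within {l..h})" if "t \<in> {l..h}" for k t
      by (cases k) (use ZD[OF sub[OF that]] in \<open>auto simp: Z'_def Y0 intro: has_field_derivative_at_within\<close>)
    have "((\<lambda>x. \<Sum>n. Y n x) has_real_derivative (\<Sum>n. Y' n r)) (at r)"
      by (rule has_field_derivative_series'(2)[OF _ dY uY lh(3) sY[OF lh(3)] int]) auto
    moreover have "((\<lambda>x. \<Sum>n. Z n x) has_real_derivative (\<Sum>n. Z' n r)) (at r)"
      by (rule has_field_derivative_series'(2)[OF _ dZ uZ lh(3) sZ[OF lh(3)] int]) auto
    moreover have "(\<Sum>n. Y' n r) = z r / P r"
    proof -
      have "(\<lambda>n. Y' (Suc n) r) sums (z r / P r)"
        unfolding Y'_def z_def using summable_sums[OF sZ[OF rin]] by (simp add: sums_divide)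
      then have "(\<lambda>n. Y' n r) sums (z r / P r)"
        by (subst (asm) sums_Suc_iff) (simp add: Y'_def)
      then show ?thesis by (rule sums_unique[symmetric])
    qed
    moreover have "(\<Sum>n. Z' n r) = - Q r * y r"
    proof -
      have "(\<lambda>n. Z' (Suc n) r) sums (- Q r * y r)"
        unfolding Z'_def y_def using sums_mult[OF summable_sums[OF sY[OF rin]], of "- Q r"] by simp
      then have "(\<lambda>n. Z' n r) sums (- Q r * y r)"
        by (subst (asm) sums_Suc_iff) (simp add: Z'_def)
      then show ?thesis by (rule sums_unique[symmetric])
    qed
    ultimately show ?thesis unfolding y_def[abs_def] z_def[abs_def] by simp
  qed
  then have "solution y z" by (simp add: solution_def)
  moreover have "y c = A"
    unfolding y_def by (subst suminf_finite[of "{0}"]) (auto simp: Y0 YZc gr0_conv_Suc)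
  moreover have "z c = B"
    unfolding z_def by (subst suminf_finite[of "{0}"]) (auto simp: Y0 YZc gr0_conv_Suc)
  ultimately show ?thesis by blast
qed

lemma solution_add:
  assumes "solution y z" "solution y' z'"
  shows "solution (\<lambda>r. y r + s * y' r) (\<lambda>r. z r + s * z' r)"
  unfolding solution_def
proof (intro ballI conjI)
  fix r assume r: "r \<in> einterval a b"
  have d: "(y has_real_derivative z r / P r) (at r)" "(y' has_real_derivative z' r / P r) (at r)"
    "(z has_real_derivative - Q r * y r) (at r)" "(z' has_real_derivative - Q r * y' r) (at r)"
    using assms r by (auto simp: solution_def)
  show "((\<lambda>r. y r + s * y' r) has_real_derivative (z r + s * z' r) / P r) (at r)"
    using DERIV_add[OF d(1) DERIV_cmult[OF d(2), of s]] by (simp add: add_divide_distrib)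
  show "((\<lambda>r. z r + s * z' r) has_real_derivative - Q r * (y r + s * y' r)) (at r)"
    using DERIV_add[OF d(3) DERIV_cmult[OF d(4), of s]] by (simp add: algebra_simps)
qed

lemma solution_cont:
  assumes "solution y z"
  shows "continuous_on (einterval a b) y" "continuous_on (einterval a b) z"
proof -
  show "continuous_on (einterval a b) y"
    by (rule DERIV_continuous_on[where D = "\<lambda>r. z r / P r"], rule has_field_derivative_at_within)
      (use assms in \<open>simp add: solution_def\<close>)
  show "continuous_on (einterval a b) z"
    by (rule DERIV_continuous_on[where D = "\<lambda>r. - Q r * y r"], rule has_field_derivative_at_within)
      (use assms in \<open>simp add: solution_def\<close>)
qed

text \<open>Gronwall's argument for the energy y^2 + z^2. Its derivative 2 y z (1/P - Q) is at most
  2 K times the energy in absolute value, so the energy times exp(-2 K t) decreases to the right of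
  \<open>c\<close> and the energy times exp(2 K t) increases to the left of it.\<close>

lemma solution_eq_0:
  assumes sol: "solution y z" and c: "c \<in> einterval a b" "y c = 0" "z c = 0" and r: "r \<in> einterval a b"
  shows "y r = 0"
proof -
  define l where "l = min c r"
  define h where "h = max c r"
  have lh: "l \<in> einterval a b" "h \<in> einterval a b" using c r by (auto simp: l_def h_def min_def max_def)
  have sub: "\<And>t. t \<in> {l..h} \<Longrightarrow> t \<in> einterval a b" using Icc_subset[OF lh] by auto
  obtain K where K: "0 < K" "\<And>t. t \<in> {l..h} \<Longrightarrow> 1 / P t \<le> K" "\<And>t. t \<in> {l..h} \<Longrightarrow> Q t \<le> K"
    using coeff_bound[OF lh] by metis
  define E where "E t = (y t)\<^sup>2 + (z t)\<^sup>2" for t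
  define E' where "E' t = 2 * y t * (z t / P t) - 2 * z t * (Q t * y t)" for t
  have dE: "(E has_real_derivative E' t) (at t)" if "t \<in> {l..h}" for t
    using sol sub[OF that] unfolding solution_def E_def[abs_def] E'_def
    by (auto intro!: derivative_eq_intros)
  have bE: "\<bar>E' t\<bar> \<le> 2 * K * E t" if t: "t \<in> {l..h}" for t
  proof -
    have "E' t = 2 * y t * z t * (1 / P t - Q t)" by (simp add: E'_def algebra_simps)
    also have "\<bar>\<dots>\<bar> = (2 * \<bar>y t\<bar> * \<bar>z t\<bar>) * \<bar>1 / P t - Q t\<bar>" by (simp add: abs_mult)
    also have "\<dots> \<le> E t * (2 * K)"
    proof (rule mult_mono)
      show "2 * \<bar>y t\<bar> * \<bar>z t\<bar> \<le> E t"
        using sum_squares_bound[of "\<bar>y t\<bar>" "\<bar>z t\<bar>"] by (simp add: E_def)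
      have "0 < 1 / P t" "0 < Q t" using P_pos Q_pos sub t by auto
      then show "\<bar>1 / P t - Q t\<bar> \<le> 2 * K" using K(1) K(2,3)[OF t] by linarith
    qed (auto simp: E_def)
    finally show ?thesis by (simp add: mult.commute)
  qed
  have Ec: "E c = 0" using c by (simp add: E_def)
  have "E r \<le> 0"
  proof (cases "c \<le> r")
    case True
    have "(\<lambda>t. E t * exp (- 2 * K * t)) r \<le> (\<lambda>t. E t * exp (- 2 * K * t)) c"
    proof (rule DERIV_nonpos_imp_nonincreasing[OF True])
      fix t assume "c \<le> t" "t \<le> r"
      then have t: "t \<in> {l..h}" by (auto simp: l_def h_def)
      have "((\<lambda>t. E t * exp (- 2 * K * t)) has_real_derivative (E' t - 2 * K * E t) * exp (- 2 * K * t)) (at t)"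
        by (auto intro!: derivative_eq_intros dE[OF t] simp: algebra_simps)
      moreover have "(E' t - 2 * K * E t) * exp (- 2 * K * t) \<le> 0"
        using bE[OF t] by (intro mult_nonpos_nonneg) auto
      ultimately show "\<exists>y. ((\<lambda>t. E t * exp (- 2 * K * t)) has_real_derivative y) (at t) \<and> y \<le> 0" by blast
    qed
    then show ?thesis by (simp add: Ec mult_le_0_iff not_le)
  next
    case False
    then have le: "r \<le> c" by simp
    have "(\<lambda>t. E t * exp (2 * K * t)) r \<le> (\<lambda>t. E t * exp (2 * K * t)) c"
    proof (rule DERIV_nonneg_imp_nondecreasing[OF le])
      fix t assume "r \<le> t" "t \<le> c"
      then have t: "t \<in> {l..h}" by (auto simp: l_def h_def)
      have "((\<lambda>t. E t * exp (2 * K * t)) has_real_derivative (E' t + 2 * K * E t) * exp (2 * K * t)) (at t)"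
        by (auto intro!: derivative_eq_intros dE[OF t] simp: algebra_simps)
      moreover have "0 \<le> (E' t + 2 * K * E t) * exp (2 * K * t)"
        using bE[OF t] by (intro mult_nonneg_nonneg) auto
      ultimately show "\<exists>y. ((\<lambda>t. E t * exp (2 * K * t)) has_real_derivative y) (at t) \<and> 0 \<le> y" by blast
    qed
    then show ?thesis by (simp add: Ec mult_le_0_iff not_le)
  qed
  moreover have "0 \<le> (z r)\<^sup>2" "0 \<le> (y r)\<^sup>2" by simp_all
  ultimately have "(y r)\<^sup>2 = 0" unfolding E_def by linarith
  then show ?thesis by simp
qed

section \<open>Positive solutions of disconjugate systems\<close>

lemma ex_less: "r \<in> einterval a b \<Longrightarrow> \<exists>l \<in> einterval a b. l < r"
proof -
  assume "r \<in> einterval a b"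
  then obtain e where "0 < e" "cball r e \<subseteq> einterval a b"
    using open_contains_cball open_einterval by metis
  then show ?thesis by (intro bexI[of _ "r - e"]) (auto simp: subset_iff dist_real_def)
qed

lemma ex_greater: "r \<in> einterval a b \<Longrightarrow> \<exists>l \<in> einterval a b. r < l"
proof -
  assume "r \<in> einterval a b"
  then obtain e where "0 < e" "cball r e \<subseteq> einterval a b"
    using open_contains_cball open_einterval by metis
  then show ?thesis by (intro bexI[of _ "r + e"]) (auto simp: subset_iff dist_real_def)
qed

lemma solution_IVT:
  assumes sol: "solution y z" and rs: "r \<in> einterval a b" "s \<in> einterval a b"
    and "r \<noteq> s" "0 < y r" "y s \<le> 0"
  obtains x where "min r s \<le> x" "x \<le> max r s" "x \<in> einterval a b" "y x = 0"
proof (cases "r \<le> s")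
  case True
  have sub: "{r..s} \<subseteq> einterval a b" by (rule Icc_subset[OF rs])
  obtain x where "r \<le> x" "x \<le> s" "y x = 0"
    using IVT2'[of y s 0 r] True assms continuous_on_subset[OF solution_cont(1)[OF sol] sub] by auto
  then show ?thesis using that[of x] sub True by auto
next
  case False
  have sub: "{s..r} \<subseteq> einterval a b" by (rule Icc_subset[OF rs(2,1)])
  obtain x where "s \<le> x" "x \<le> r" "y x = 0"
    using IVT'[of y s 0 r] False assms continuous_on_subset[OF solution_cont(1)[OF sol] sub] by auto
  then show ?thesis using that[of x] sub False by auto
qed

text \<open>In the pencil y0 + t y1 the parameter \<open>t r\<close> gives the member vanishing at
  \<open>r\<close>. Disconjugacy places all parameters belonging to points right of \<open>c\<close>
  below all those belonging to points left of \<open>c\<close>. The supremum of the former therefore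
  exists and avoids zeros on the left; on the right a zero could only be double, which uniqueness
  forbids.\<close>

lemma positive_solution_exists:
  assumes ab: "a < b"
    and disconjugate: "\<And>y z \<alpha> \<beta> r. solution y z \<Longrightarrow> \<alpha> \<in> einterval a b \<Longrightarrow> \<beta> \<in> einterval a b \<Longrightarrow> \<alpha> < \<beta> \<Longrightarrow>
       y \<alpha> = 0 \<Longrightarrow> y \<beta> = 0 \<Longrightarrow> r \<in> einterval a b \<Longrightarrow> y r = 0"
  shows "\<exists>y z. solution y z \<and> (\<forall>r\<in>einterval a b. 0 < y r)"
proof -
  obtain c where c: "c \<in> einterval a b" using einterval_nonempty[OF ab] by blast
  obtain y0 z0 where s0: "solution y0 z0" "y0 c = 1" "z0 c = 0" using solution_exists[OF c] by blast
  obtain y1 z1 where s1: "solution y1 z1" "y1 c = 0" "z1 c = 1" using solution_exists[OF c] by blast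
  \<comment> \<open>A solution that vanishes at \<alpha> keeps its sign on each side of \<alpha>: a
    change between \<open>p\<close> and \<open>r\<close> would create a second zero by the
    intermediate value theorem.\<close>
  have one_zero: "0 < y r"
    if H: "solution y z" "\<alpha> \<in> einterval a b" "y \<alpha> = 0" "p \<in> einterval a b" "0 < y p" "r \<in> einterval a b"
      "(\<alpha> < p \<and> \<alpha> < r) \<or> (p < \<alpha> \<and> r < \<alpha>)" for y z \<alpha> p r
  proof (rule ccontr)
    assume neg: "\<not> 0 < y r"
    then have "p \<noteq> r" using H by auto
    then obtain x where x: "min p r \<le> x" "x \<le> max p r" "x \<in> einterval a b" "y x = 0"
      using solution_IVT[OF H(1) H(4,6)] H neg by auto
    have "y p = 0"
      using disconjugate[OF H(1) H(2) x(3) _ H(3) x(4) H(4)]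
        disconjugate[OF H(1) x(3) H(2) _ x(4) H(3) H(4)] H(7) x(1,2) by linarith
    then show False using H by simp
  qed
  have d1: "(y1 has_real_derivative 1 / P c) (at c)" using s1 c by (auto simp: solution_def)
  have y1_pos: "0 < y1 r" if r: "r \<in> einterval a b" "c < r" for r
  proof -
    obtain d where d: "0 < d" "\<And>h. 0 < h \<Longrightarrow> h < d \<Longrightarrow> y1 c < y1 (c + h)"
      using DERIV_pos_inc_right[OF d1] P_pos[OF c] by auto
    define h where "h = min (d / 2) (r - c)"
    have h: "0 < h" "h < d" "c + h \<le> r" using d r by (auto simp: h_def min_def)
    then have "c + h \<in> einterval a b" using Icc_subset[OF c r(1)] by auto
    then show ?thesis using one_zero[OF s1(1) c s1(2), of "c + h" r] d(2)[OF h(1,2)] h r s1 by auto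
  qed
  have y1_neg: "y1 r < 0" if r: "r \<in> einterval a b" "r < c" for r
  proof -
    obtain d where d: "0 < d" "\<And>h. 0 < h \<Longrightarrow> h < d \<Longrightarrow> y1 (c - h) < y1 c"
      using DERIV_pos_inc_left[OF d1] P_pos[OF c] by auto
    define h where "h = min (d / 2) (c - r)"
    have h: "0 < h" "h < d" "r \<le> c - h" using d r by (auto simp: h_def min_def)
    then have "c - h \<in> einterval a b" using Icc_subset[OF r(1) c] by auto
    \<comment> \<open>This is minus \<open>y1\<close>, written so that \<open>solution_add\<close>
      applies; it is positive immediately to the left of \<open>c\<close>.\<close>
    moreover have "solution (\<lambda>r. y1 r + -2 * y1 r) (\<lambda>r. z1 r + -2 * z1 r)"
      by (rule solution_add[OF s1(1) s1(1)])
    ultimately show ?thesis using one_zero[of "\<lambda>r. y1 r + -2 * y1 r" _ c "c - h" r] c d(2)[OF h(1,2)] h r s1 by auto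
  qed
  define t where "t r = - y0 r / y1 r" for r
  have combo: "0 < y0 r + t \<alpha> * y1 r" if "\<alpha> \<in> einterval a b" "\<alpha> < c" "r \<in> einterval a b" "\<alpha> < r" for \<alpha> r
    by (rule one_zero[OF solution_add[OF s0(1) s1(1)] that(1), where p = c])
      (use y1_neg[OF that(1,2)] c that s0 s1 in \<open>auto simp: t_def\<close>)
  \<comment> \<open>The member vanishing at \<alpha> is positive everywhere to the right of
    \<alpha>, in particular at \<open>r\<close>; dividing by \<open>y1 r > 0\<close> compares the
    parameters.\<close>
  have t_less: "t r < t \<alpha>" if "\<alpha> \<in> einterval a b" "\<alpha> < c" "r \<in> einterval a b" "c < r" for \<alpha> r
    using combo[OF that(1,2,3)] y1_pos[OF that(3,4)] that
    by (simp add: t_def[of r] field_simps)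
  define G where "G = t ` {r \<in> einterval a b. c < r}"
  define s where "s = Sup G"
  have G: "G \<noteq> {}" using ex_greater[OF c] by (auto simp: G_def)
  have s_le: "s \<le> t \<alpha>" if "\<alpha> \<in> einterval a b" "\<alpha> < c" for \<alpha>
    unfolding s_def using G by (rule cSup_least) (auto simp: G_def intro!: less_imp_le[OF t_less[OF that]])
  have bdd: "bdd_above G"
    using ex_less[OF c] t_less by (force simp: G_def intro!: bdd_aboveI2 less_imp_le)
  have s_ge: "t r \<le> s" if "r \<in> einterval a b" "c < r" for r
    unfolding s_def by (rule cSup_upper[OF _ bdd]) (use that in \<open>auto simp: G_def\<close>)
  let ?y = "\<lambda>r. y0 r + s * y1 r" and ?z = "\<lambda>r. z0 r + s * z1 r"
  have sol: "solution ?y ?z" by (rule solution_add[OF s0(1) s1(1)])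
  have yc: "?y c = 1" using s0 s1 by simp
  have nonneg: "0 \<le> ?y r" if "r \<in> einterval a b" "c < r" for r
    using s_ge[OF that] y1_pos[OF that] by (simp add: t_def field_simps)
  have "0 < ?y r" if r: "r \<in> einterval a b" for r
  proof -
    consider "r = c" | "r < c" | "c < r" by linarith
    then show ?thesis
    proof cases
      case 1 then show ?thesis using yc by simp
    next
      case 2
      \<comment> \<open>A point strictly left of \<open>r\<close> yields strict positivity:
        \<open>y1 r\<close> is negative and \<open>s\<close> is at most \<open>t \<alpha>\<close>,
        so the extremal member dominates at \<open>r\<close> the one vanishing at \<alpha>, which is
        positive there.\<close>
      obtain \<alpha> where \<alpha>: "\<alpha> \<in> einterval a b" "\<alpha> < r" using ex_less[OF r] by blast
      have "t \<alpha> * y1 r \<le> s * y1 r" using s_le[of \<alpha>] \<alpha> 2 y1_neg[OF r 2] by (intro mult_right_mono_neg) auto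
      then show ?thesis using combo[of \<alpha> r] \<alpha> 2 r by auto
    next
      case 3
      \<comment> \<open>A zero of a nonnegative function at an interior point is a local minimum, so
        \<open>z\<close> would vanish there too and the solution would be identically 0, contrary to
        its value 1 at \<open>c\<close>.\<close>
      have "?y r \<noteq> 0"
      proof
        assume y0: "?y r = 0"
        obtain e where e: "0 < e" "cball r e \<subseteq> einterval a b"
          using open_contains_cball open_einterval r by metis
        have "?z r / P r = 0"
        proof (rule DERIV_local_min)
          show "(?y has_real_derivative ?z r / P r) (at r)" using sol r unfolding solution_def by blast
          show "0 < min e (r - c)" using e 3 by simp
          show "\<forall>x. \<bar>r - x\<bar> < min e (r - c) \<longrightarrow> ?y r \<le> ?y x"
            using e nonneg y0 by (auto simp: subset_iff dist_real_def)
        qed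
        then have "?z r = 0" using P_pos[OF r] by simp
        then show False using solution_eq_0[OF sol r y0 _ c] yc by simp
      qed
      then show ?thesis using nonneg[OF r 3] by simp
    qed
  qed
  then show ?thesis using sol by blast
qed

text \<open>The strict margins between \<open>lo\<close>, \<open>l\<close> and between
  \<open>u\<close>, \<open>hi\<close> leave room for a smooth bump on the larger interval: the
  quotient of \<open>f\<close> by that bump then vanishes near \<open>lo\<close> and
  \<open>hi\<close>, where the bump degenerates.\<close>

definition nonneg_form :: bool where
  "nonneg_form \<longleftrightarrow> (\<forall>f f' lo l u hi. lo \<in> einterval a b \<longrightarrow> hi \<in> einterval a b \<longrightarrow> lo < l \<longrightarrow> l < u \<longrightarrow> u < hi \<longrightarrow>
     (\<forall>r. (f has_real_derivative f' r) (at r)) \<longrightarrow> continuous_on UNIV f' \<longrightarrow>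
     (\<forall>r. r \<notin> {l..u} \<longrightarrow> f r = 0 \<and> f' r = 0) \<longrightarrow>
     0 \<le> integral {lo..hi} (\<lambda>r. P r * (f' r)\<^sup>2 - Q r * (f r)\<^sup>2))"

text \<open>If \<open>y\<close> vanished at \<open>\<alpha> < \<beta>\<close>, its truncation to \<open>[\<alpha>, \<beta>]\<close> would be a null vector of the form,
  although its pairing with a bump \<open>\<eta>\<close> supported to the right of \<open>\<alpha>\<close> is \<open>z \<beta> * \<eta> \<beta> \<noteq> 0\<close>. The truncation
  is made \<open>C\<^sup>1\<close> by applying \<open>\<theta> t = t - d * arctan (t / d)\<close>, which is flat at \<open>0\<close>.\<close>

lemma disconjugate:
  assumes form: nonneg_form
    and sol: "solution y z" and \<alpha>: "\<alpha> \<in> einterval a b" and \<beta>: "\<beta> \<in> einterval a b" and "\<alpha> < \<beta>"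
    and y0: "y \<alpha> = 0" "y \<beta> = 0" and r: "r \<in> einterval a b"
  shows "y r = 0"
proof (rule ccontr)
  assume "y r \<noteq> 0"
  then have z\<beta>: "z \<beta> \<noteq> 0" using solution_eq_0[OF sol \<beta> y0(2) _ r] by auto
  obtain lo where lo: "lo \<in> einterval a b" "lo < \<alpha>" using ex_less[OF \<alpha>] by blast
  obtain g where g: "g \<in> einterval a b" "\<beta> < g" using ex_greater[OF \<beta>] by blast
  obtain hi where hi: "hi \<in> einterval a b" "g < hi" using ex_greater[OF g(1)] by blast
  have sub: "{lo..hi} \<subseteq> einterval a b" by (rule Icc_subset[OF lo(1) hi(1)])
  have sub': "{\<alpha>..\<beta>} \<subseteq> einterval a b" by (rule Icc_subset[OF \<alpha> \<beta>])
  have dy: "(y has_real_derivative z t / P t) (at t)" and dz: "(z has_real_derivative - Q t * y t) (at t)"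
    if "t \<in> {\<alpha>..\<beta>}" for t
    using sol sub' that by (auto simp: solution_def)
  have cy: "continuous_on {\<alpha>..\<beta>} y" and cz: "continuous_on {\<alpha>..\<beta>} z"
    using solution_cont[OF sol] sub' continuous_on_subset by blast+
  have cP: "continuous_on {lo..hi} P" and cQ: "continuous_on {lo..hi} Q" and cP': "continuous_on {lo..hi} P'"
    using P_cont Q_cont P'_cont sub continuous_on_subset by blast+
  have in1: "{\<alpha>..\<beta>} \<subseteq> {lo..hi}" using lo g hi by auto
  have cP1: "continuous_on {\<alpha>..\<beta>} P" and cQ1: "continuous_on {\<alpha>..\<beta>} Q" and cP'1: "continuous_on {\<alpha>..\<beta>} P'"
    using cP cQ cP' in1 continuous_on_subset by blast+
  have Ppos: "0 < P t" if "t \<in> {\<alpha>..\<beta>}" for t using P_pos sub' that by auto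
  have P0: "\<forall>t\<in>{\<alpha>..\<beta>}. P t \<noteq> 0" using Ppos by force
  have Qpos: "0 < Q t" if "t \<in> {\<alpha>..\<beta>}" for t using Q_pos sub' that by auto
  \<comment> \<open>Double zeros at \<alpha> and \<open>g\<close> make the extension by 0 a C^1
    function. As \<open>g\<close> lies beyond \<beta>, the bump is positive at \<beta>, which is
    what makes the pairing with the cut-off solution nonzero.\<close>
  define e where "e t = (t - \<alpha>)\<^sup>2 * (g - t)\<^sup>2" for t
  define e1 where "e1 t = 2 * (t - \<alpha>) * (g - t)\<^sup>2 - 2 * (t - \<alpha>)\<^sup>2 * (g - t)" for t
  define e2 where "e2 t = 2 * (g - t)\<^sup>2 - 8 * (t - \<alpha>) * (g - t) + 2 * (t - \<alpha>)\<^sup>2" for t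
  have de: "(e has_real_derivative e1 t) (at t)" for t
    unfolding e_def[abs_def] e1_def by (auto intro!: derivative_eq_intros simp: algebra_simps power2_eq_square)
  have de1: "(e1 has_real_derivative e2 t) (at t)" for t
    unfolding e1_def[abs_def] e2_def by (auto intro!: derivative_eq_intros simp: algebra_simps power2_eq_square)
  have ce: "continuous_on S e" "continuous_on S e1" "continuous_on S e2" for S
    unfolding e_def[abs_def] e1_def[abs_def] e2_def[abs_def] by (intro continuous_intros)+
  define \<eta> where "\<eta> t = (if t \<in> {\<alpha>..g} then e t else 0)" for t
  define \<eta>1 where "\<eta>1 t = (if t \<in> {\<alpha>..g} then e1 t else 0)" for t
  have d\<eta>: "(\<eta> has_real_derivative \<eta>1 t) (at t)" for t
    unfolding \<eta>_def[abs_def] \<eta>1_def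
    by (rule extend_by_zero(1)[OF de _ ce(2)]) (use \<open>\<alpha> < \<beta>\<close> g in \<open>auto simp: e_def e1_def\<close>)
  have c\<eta>1: "continuous_on UNIV \<eta>1"
    unfolding \<eta>1_def[abs_def]
    by (rule extend_by_zero(2)[OF de _ ce(2)]) (use \<open>\<alpha> < \<beta>\<close> g in \<open>auto simp: e_def e1_def\<close>)
  have c\<eta>: "continuous_on S \<eta>" for S
    using d\<eta> by (meson DERIV_continuous_on has_field_derivative_at_within)
  \<comment> \<open>This is (P e')' + Q e, the Sturm--Liouville operator applied to the bump.
    Pairing a function \<open>h\<close> that vanishes at \<alpha> and \<beta> with the bump gives
    minus the integral of \<open>K * h\<close>.\<close>
  define K where "K t = P' t * e1 t + P t * e2 t + Q t * e t" for t
  have cK: "continuous_on {\<alpha>..\<beta>} K"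
    unfolding K_def[abs_def] by (intro continuous_intros ce cP1 cQ1 cP'1)
  define I2 where "I2 = integral {lo..hi} (\<lambda>r. P r * (\<eta>1 r)\<^sup>2 - Q r * (\<eta> r)\<^sup>2)"
  define B0 where "B0 = z \<beta> * e \<beta>"
  define C1 where "C1 = integral {\<alpha>..\<beta>} (\<lambda>t. Q t * (2 * (\<bar>y t\<bar> + 2)))"
  define C2 where "C2 = integral {\<alpha>..\<beta>} (\<lambda>t. 2 * \<bar>K t\<bar>)"
  \<comment> \<open>The form is evaluated at the flattened truncation plus \<open>s\<close> times
    the bump. Its three terms are O(d), 2 s \<open>B0\<close> + O(d) and
    \<open>s\<^sup>2 * I2\<close>, with constants independent of \<open>d\<close>, so that
    \<open>d\<close> can tend to 0 for fixed \<open>s\<close>.\<close>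
  have key: "0 \<le> C1 * d + 2 * (s * B0 + \<bar>s\<bar> * (C2 * d)) + s\<^sup>2 * I2" if d: "0 < d" "d \<le> 1" for d s
  proof -
    define \<theta> where "\<theta> t = t - d * arctan (t / d)" for t
    define \<theta>1 where "\<theta>1 t = 1 - 1 / (1 + (t / d)\<^sup>2)" for t
    have d\<theta>: "(\<theta> has_real_derivative \<theta>1 t) (at t)" for t
      unfolding \<theta>_def[abs_def] \<theta>1_def using d
      by (auto intro!: derivative_eq_intros simp: divide_inverse)
    have \<theta>1: "0 \<le> \<theta>1 t" "\<theta>1 t \<le> 1" for t
      unfolding \<theta>1_def by (simp_all add: divide_le_eq add_pos_nonneg)
    have \<theta>0: "\<theta> 0 = 0" "\<theta>1 0 = 0" by (simp_all add: \<theta>_def \<theta>1_def)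
    have \<theta>d: "\<bar>t - \<theta> t\<bar> \<le> 2 * d" for t
    proof -
      have "\<bar>arctan (t / d)\<bar> \<le> 2"
        using arctan_lbound[of "t/d"] arctan_ubound[of "t/d"] pi_less_4 by linarith
      then have "d * \<bar>arctan (t / d)\<bar> \<le> d * 2" using d by (intro mult_left_mono) auto
      then show ?thesis using d by (simp add: \<theta>_def abs_mult)
    qed
    have \<theta>b: "\<bar>\<theta> t\<bar> \<le> \<bar>t\<bar> + 2" for t using \<theta>d[of t] d by linarith
    have c\<theta>1: "continuous_on S \<theta>1" for S
      unfolding \<theta>1_def[abs_def] using d
      by (intro continuous_intros) (auto simp: add_nonneg_eq_0_iff)
    have c\<theta>: "continuous_on S \<theta>" for S
      using d\<theta> by (meson DERIV_continuous_on has_field_derivative_at_within)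
    define h where "h t = \<theta> (y t)" for t
    define h1 where "h1 t = \<theta>1 (y t) * (z t / P t)" for t
    have dh: "(h has_real_derivative h1 t) (at t)" if "t \<in> {\<alpha>..\<beta>}" for t
      unfolding h_def[abs_def] h1_def by (rule DERIV_chain2[OF d\<theta> dy[OF that]])
    have ch1: "continuous_on {\<alpha>..\<beta>} h1"
      unfolding h1_def[abs_def]
      by (intro continuous_intros continuous_on_compose2[OF c\<theta>1 cy] cz cP1 P0) auto
    have ch: "continuous_on {\<alpha>..\<beta>} h"
      unfolding h_def[abs_def] by (intro continuous_on_compose2[OF c\<theta> cy]) auto
    define f where "f t = (if t \<in> {\<alpha>..\<beta>} then h t else 0)" for t
    define f1 where "f1 t = (if t \<in> {\<alpha>..\<beta>} then h1 t else 0)" for t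
    have df: "(f has_real_derivative f1 t) (at t)" for t
      unfolding f_def[abs_def] f1_def
      by (rule extend_by_zero(1)[OF dh _ ch1]) (use \<open>\<alpha> < \<beta>\<close> y0 \<theta>0 in \<open>auto simp: h_def h1_def\<close>)
    have cf1: "continuous_on UNIV f1"
      unfolding f1_def[abs_def]
      by (rule extend_by_zero(2)[OF dh _ ch1]) (use \<open>\<alpha> < \<beta>\<close> y0 \<theta>0 in \<open>auto simp: h_def h1_def\<close>)
    have cf: "continuous_on S f" for S
      using df by (meson DERIV_continuous_on has_field_derivative_at_within)
    have c': "continuous_on S f1" "continuous_on S \<eta>1" for S
      using cf1 c\<eta>1 continuous_on_subset by blast+
    define F where "F t = f t + s * \<eta> t" for t
    define F1 where "F1 t = f1 t + s * \<eta>1 t" for t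
    have "0 \<le> integral {lo..hi} (\<lambda>r. P r * (F1 r)\<^sup>2 - Q r * (F r)\<^sup>2)"
    proof (rule form[unfolded nonneg_form_def, rule_format])
      show "lo \<in> einterval a b" "hi \<in> einterval a b" "lo < \<alpha>" "\<alpha> < g" "g < hi"
        using lo hi g \<open>\<alpha> < \<beta>\<close> by auto
      show "(F has_real_derivative F1 r) (at r)" for r
        unfolding F_def[abs_def] F1_def by (rule DERIV_add[OF df DERIV_cmult[OF d\<eta>]])
      show "continuous_on UNIV F1" unfolding F1_def[abs_def] by (intro continuous_intros c')
      show "F r = 0 \<and> F1 r = 0" if "r \<notin> {\<alpha>..g}" for r
        using that g by (auto simp: F_def F1_def f_def f1_def \<eta>_def \<eta>1_def)
    qed
    also have "\<dots> = integral {lo..hi} (\<lambda>r. (P r * (f1 r)\<^sup>2 - Q r * (f r)\<^sup>2)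
       + ((2 * s) * (P r * (f1 r * \<eta>1 r) - Q r * (f r * \<eta> r)) + s\<^sup>2 * (P r * (\<eta>1 r)\<^sup>2 - Q r * (\<eta> r)\<^sup>2)))"
      by (rule integral_cong) (simp add: F_def F1_def algebra_simps power2_eq_square)
    also have "\<dots> = integral {lo..hi} (\<lambda>r. P r * (f1 r)\<^sup>2 - Q r * (f r)\<^sup>2)
       + (integral {lo..hi} (\<lambda>r. (2 * s) * (P r * (f1 r * \<eta>1 r) - Q r * (f r * \<eta> r)))
       + integral {lo..hi} (\<lambda>r. s\<^sup>2 * (P r * (\<eta>1 r)\<^sup>2 - Q r * (\<eta> r)\<^sup>2)))"
      by (subst integral_add | intro integrable_continuous_interval continuous_intros cP cQ cf c\<eta> c' refl)+
    also have "integral {lo..hi} (\<lambda>r. (2 * s) * (P r * (f1 r * \<eta>1 r) - Q r * (f r * \<eta> r)))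
      = 2 * s * integral {lo..hi} (\<lambda>r. P r * (f1 r * \<eta>1 r) - Q r * (f r * \<eta> r))" by simp
    also have "integral {lo..hi} (\<lambda>r. s\<^sup>2 * (P r * (\<eta>1 r)\<^sup>2 - Q r * (\<eta> r)\<^sup>2)) = s\<^sup>2 * I2" by (simp add: I2_def)
    finally have main: "0 \<le> integral {lo..hi} (\<lambda>r. P r * (f1 r)\<^sup>2 - Q r * (f r)\<^sup>2)
       + (2 * s * integral {lo..hi} (\<lambda>r. P r * (f1 r * \<eta>1 r) - Q r * (f r * \<eta> r)) + s\<^sup>2 * I2)" .
    have "integral {lo..hi} (\<lambda>r. P r * (f1 r)\<^sup>2 - Q r * (f r)\<^sup>2)
      = integral {lo..hi} (\<lambda>r. if r \<in> {\<alpha>..\<beta>} then P r * (h1 r)\<^sup>2 - Q r * (h r)\<^sup>2 else 0)"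
      by (rule integral_cong) (simp add: f_def f1_def)
    also have "\<dots> = integral {\<alpha>..\<beta>} (\<lambda>r. P r * (h1 r)\<^sup>2 - Q r * (h r)\<^sup>2)"
      unfolding integral_def integrable_on_def has_integral_restrict[OF in1] ..
    \<comment> \<open>The bracket is the derivative of \<open>z * h\<close>, whose integral
      vanishes. Since \<theta>' lies in [0,1], \<open>P * h1\<^sup>2\<close> is at most
      \<open>z * h1\<close>; exchanging one factor \<open>h\<close> for \<open>y\<close> in
      \<open>Q * h\<^sup>2\<close> costs O(d).\<close>
    also have "\<dots> \<le> integral {\<alpha>..\<beta>} (\<lambda>r. (- Q r * y r * h r + z r * h1 r) + Q r * (2 * (\<bar>y r\<bar> + 2)) * d)"
    proof (rule integral_le)
      fix r assume r: "r \<in> {\<alpha>..\<beta>}"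
      have "P r * (h1 r)\<^sup>2 = \<theta>1 (y r) * (z r * h1 r)"
        using Ppos[OF r] by (simp add: h1_def power2_eq_square)
      also have "\<dots> \<le> 1 * (z r * h1 r)"
      proof (rule mult_right_mono)
        have "z r * h1 r = \<theta>1 (y r) * ((z r)\<^sup>2 / P r)" by (simp add: h1_def power2_eq_square)
        then show "0 \<le> z r * h1 r" using \<theta>1 Ppos[OF r] by simp
      qed (rule \<theta>1)
      finally have 1: "P r * (h1 r)\<^sup>2 \<le> z r * h1 r" by simp
      have "h r * (y r - h r) \<le> \<bar>h r\<bar> * \<bar>y r - h r\<bar>" by (metis abs_ge_self abs_mult)
      also have "\<dots> \<le> (\<bar>y r\<bar> + 2) * (2 * d)"
        unfolding h_def by (intro mult_mono \<theta>b \<theta>d) auto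
      finally have "Q r * (h r * (y r - h r)) \<le> Q r * ((\<bar>y r\<bar> + 2) * (2 * d))"
        using Qpos[OF r] by (intro mult_left_mono) auto
      then show "P r * (h1 r)\<^sup>2 - Q r * (h r)\<^sup>2 \<le> (- Q r * y r * h r + z r * h1 r) + Q r * (2 * (\<bar>y r\<bar> + 2)) * d"
        using 1 by (simp add: algebra_simps power2_eq_square)
    qed (intro integrable_continuous_interval continuous_intros cP1 cQ1 ch ch1 cy cz)+
    also have "\<dots> = integral {\<alpha>..\<beta>} (\<lambda>r. - Q r * y r * h r + z r * h1 r) + integral {\<alpha>..\<beta>} (\<lambda>r. Q r * (2 * (\<bar>y r\<bar> + 2)) * d)"
      by (intro integral_add integrable_continuous_interval continuous_intros cP1 cQ1 ch ch1 cy cz)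
    also have "integral {\<alpha>..\<beta>} (\<lambda>r. Q r * (2 * (\<bar>y r\<bar> + 2)) * d) = C1 * d" by (simp add: C1_def)
    also have "integral {\<alpha>..\<beta>} (\<lambda>r. - Q r * y r * h r + z r * h1 r) = 0"
    proof -
      have "((\<lambda>r. - Q r * y r * h r + z r * h1 r) has_integral (z \<beta> * h \<beta> - z \<alpha> * h \<alpha>)) {\<alpha>..\<beta>}"
      proof (rule FTC_real)
        show "((\<lambda>r. z r * h r) has_real_derivative - Q r * y r * h r + z r * h1 r) (at r)" if "r \<in> {\<alpha>..\<beta>}" for r
          using DERIV_mult[OF dz[OF that] dh[OF that]] by (simp add: mult.commute)
      qed (use \<open>\<alpha> < \<beta>\<close> in simp)
      then show ?thesis using y0 \<theta>0 by (simp add: h_def integral_unique)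
    qed
    finally have I1: "integral {lo..hi} (\<lambda>r. P r * (f1 r)\<^sup>2 - Q r * (f r)\<^sup>2) \<le> C1 * d" by simp
    \<comment> \<open>Integration by parts moves every derivative from \<open>h\<close> onto the
      bump. Replacing \<open>h\<close> by \<open>y\<close> then needs only the uniform bound 2 d on
      their difference, and no control of the derivatives.\<close>
    define B where "B = integral {lo..hi} (\<lambda>r. P r * (f1 r * \<eta>1 r) - Q r * (f r * \<eta> r))"
    have "B = integral {lo..hi} (\<lambda>r. if r \<in> {\<alpha>..\<beta>} then P r * (h1 r * e1 r) - Q r * (h r * e r) else 0)"
      unfolding B_def using g by (intro integral_cong) (auto simp: f_def f1_def \<eta>_def \<eta>1_def)
    also have "\<dots> = integral {\<alpha>..\<beta>} (\<lambda>r. P r * (h1 r * e1 r) - Q r * (h r * e r))"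
      unfolding integral_def integrable_on_def has_integral_restrict[OF in1] ..
    also have "\<dots> = integral {\<alpha>..\<beta>} (\<lambda>r. (P' r * e1 r * h r + P r * e2 r * h r + P r * e1 r * h1 r) - K r * h r)"
      by (rule integral_cong) (simp add: K_def algebra_simps)
    also have "\<dots> = integral {\<alpha>..\<beta>} (\<lambda>r. P' r * e1 r * h r + P r * e2 r * h r + P r * e1 r * h1 r) - integral {\<alpha>..\<beta>} (\<lambda>r. K r * h r)"
      by (intro integral_diff integrable_continuous_interval continuous_intros cP1 cQ1 cP'1 ch ch1 cK ce)
    also have "integral {\<alpha>..\<beta>} (\<lambda>r. P' r * e1 r * h r + P r * e2 r * h r + P r * e1 r * h1 r) = 0"
    proof -
      have "((\<lambda>r. P' r * e1 r * h r + P r * e2 r * h r + P r * e1 r * h1 r) has_integral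
          (P \<beta> * e1 \<beta> * h \<beta> - P \<alpha> * e1 \<alpha> * h \<alpha>)) {\<alpha>..\<beta>}"
      proof (rule FTC_real)
        show "((\<lambda>r. P r * e1 r * h r) has_real_derivative P' r * e1 r * h r + P r * e2 r * h r + P r * e1 r * h1 r) (at r)"
          if r: "r \<in> {\<alpha>..\<beta>}" for r
        proof -
          have "(P has_real_derivative P' r) (at r)" using P_deriv sub' r by auto
          from DERIV_mult[OF DERIV_mult[OF this de1] dh[OF r]] show ?thesis
            by (simp add: algebra_simps)
        qed
      qed (use \<open>\<alpha> < \<beta>\<close> in simp)
      then show ?thesis using y0 \<theta>0 by (simp add: h_def integral_unique)
    qed
    finally have B1: "B = - integral {\<alpha>..\<beta>} (\<lambda>r. K r * h r)" by simp
    have "((\<lambda>r. K r * y r) has_integral (P \<beta> * e1 \<beta> * y \<beta> - z \<beta> * e \<beta> - (P \<alpha> * e1 \<alpha> * y \<alpha> - z \<alpha> * e \<alpha>))) {\<alpha>..\<beta>}"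
    proof -
      have D: "((\<lambda>r. P r * e1 r * y r - z r * e r) has_real_derivative K r * y r) (at r)"
        if r: "r \<in> {\<alpha>..\<beta>}" for r
      proof -
        have "(P has_real_derivative P' r) (at r)" using P_deriv sub' r by auto
        from DERIV_diff[OF DERIV_mult[OF DERIV_mult[OF this de1] dy[OF r]] DERIV_mult[OF dz[OF r] de]]
        show ?thesis using Ppos[OF r] by (simp add: K_def algebra_simps)
      qed
      show ?thesis using FTC_real[OF _ D] \<open>\<alpha> < \<beta>\<close> by simp
    qed
    then have B2: "integral {\<alpha>..\<beta>} (\<lambda>r. K r * y r) = - B0"
      using y0 by (simp add: integral_unique B0_def e_def)
    have "\<bar>B - B0\<bar> = \<bar>integral {\<alpha>..\<beta>} (\<lambda>r. K r * y r - K r * h r)\<bar>"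
      unfolding B1 using B2
      by (subst integral_diff) (auto intro!: integrable_continuous_interval continuous_intros cK cy ch)
    also have "\<dots> \<le> integral {\<alpha>..\<beta>} (\<lambda>t. 2 * \<bar>K t\<bar> * d)"
      unfolding real_norm_def[symmetric]
    proof (rule integral_norm_bound_integral)
      show "norm (K x * y x - K x * h x) \<le> 2 * norm (K x) * d" if "x \<in> {\<alpha>..\<beta>}" for x
      proof -
        have "norm (K x * y x - K x * h x) = \<bar>K x\<bar> * \<bar>y x - h x\<bar>"
          by (simp add: right_diff_distrib[symmetric] abs_mult)
        also have "\<dots> \<le> \<bar>K x\<bar> * (2 * d)" unfolding h_def by (intro mult_left_mono \<theta>d) auto
        finally show ?thesis by (simp add: mult_ac)
      qed
    qed (intro integrable_continuous_interval continuous_intros cK cy ch)+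
    also have "\<dots> = C2 * d" by (simp add: C2_def)
    finally have "\<bar>B - B0\<bar> \<le> C2 * d" .
    then have "\<bar>s\<bar> * \<bar>B - B0\<bar> \<le> \<bar>s\<bar> * (C2 * d)" by (intro mult_left_mono) auto
    then have "s * (B - B0) \<le> \<bar>s\<bar> * (C2 * d)" by (metis abs_ge_self abs_mult order_trans)
    then show ?thesis using main I1 unfolding B_def[symmetric] by (simp add: algebra_simps)
  qed
  have lim: "0 \<le> 2 * s * B0 + s\<^sup>2 * I2" for s
  proof -
    have "((\<lambda>d. C1 * d + 2 * (s * B0 + \<bar>s\<bar> * (C2 * d)) + s\<^sup>2 * I2) \<longlongrightarrow>
       C1 * 0 + 2 * (s * B0 + \<bar>s\<bar> * (C2 * 0)) + s\<^sup>2 * I2) (at_right 0)"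
      by (intro tendsto_intros)
    moreover have "\<forall>\<^sub>F d in at_right 0. 0 \<le> C1 * d + 2 * (s * B0 + \<bar>s\<bar> * (C2 * d)) + s\<^sup>2 * I2"
      using key by (auto simp: eventually_at_right_field intro!: exI[of _ 1])
    ultimately have "0 \<le> C1 * 0 + 2 * (s * B0 + \<bar>s\<bar> * (C2 * 0)) + s\<^sup>2 * I2"
      by (rule tendsto_lowerbound) simp
    then show ?thesis by simp
  qed
  have B0: "B0 \<noteq> 0" using z\<beta> g \<open>\<alpha> < \<beta>\<close> by (simp add: B0_def e_def)
  \<comment> \<open>A positive upper bound for \<open>I2\<close>, whatever its sign. With
    \<open>s = - B0 / M\<close> the linear term beats the quadratic one and the total is at most
    -B0^2/M < 0.\<close>
  define M where "M = \<bar>I2\<bar> + 1"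
  have M: "0 < M" "I2 \<le> M" by (auto simp: M_def)
  have "2 * (- B0 / M) * B0 + (- B0 / M)\<^sup>2 * I2 \<le> 2 * (- B0 / M) * B0 + (- B0 / M)\<^sup>2 * M"
    using M by (intro add_left_mono mult_left_mono) auto
  also have "\<dots> = - (B0\<^sup>2 / M)" using M by (simp add: power2_eq_square field_simps)
  also have "\<dots> < 0" using B0 M by simp
  finally show False using lim[of "- B0 / M"] by simp
qed

section \<open>Sign of the flux and the one-dimensional inequality\<close>

lemma solution_z_nonincreasing:
  assumes sol: "solution y z" and pos: "\<And>r. r \<in> einterval a b \<Longrightarrow> 0 < y r"
    and rs: "r \<in> einterval a b" "s \<in> einterval a b" "r \<le> s"
  shows "z s \<le> z r"
proof (rule DERIV_nonpos_imp_nonincreasing[OF rs(3)])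
  fix x assume "r \<le> x" "x \<le> s"
  then have x: "x \<in> einterval a b" using Icc_subset[OF rs(1,2)] by auto
  have "0 \<le> Q x * y x" using Q_pos[OF x] pos[OF x] by simp
  then show "\<exists>y. (z has_real_derivative y) (at x) \<and> y \<le> 0"
    using sol x unfolding solution_def by (intro exI[of _ "- Q x * y x"]) auto
qed

text \<open>If \<open>z r = m > 0\<close>, then z >= m on (0,r] by monotonicity, hence y' >= m/P
  there. Since \<open>y\<close> is positive, the integral of 1/P over \<open>{l..d}\<close> is at
  most \<open>y d / m\<close> for every \<open>l\<close>, contradicting divergence at 0.\<close>

lemma solution_z_nonpos:
  assumes a0: "a = 0" and sol: "solution y z" and pos: "\<And>r. r \<in> einterval a b \<Longrightarrow> 0 < y r"
    and c: "c \<in> einterval a b" and inf: "(\<integral>\<^sup>+r\<in>{0<..<c}. ennreal (1 / P r) \<partial>lborel) = \<infinity>"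
    and r: "r \<in> einterval a b"
  shows "z r \<le> 0"
proof (rule ccontr)
  assume "\<not> z r \<le> 0"
  define m where "m = z r"
  have m: "0 < m" using \<open>\<not> z r \<le> 0\<close> by (simp add: m_def)
  \<comment> \<open>The lower bound on \<open>z\<close> holds only up to \<open>r\<close>, while
    divergence is stated up to \<open>c\<close>. The stretch \<open>{d..c}\<close> contributes a
    finite amount, because \<open>1 / P\<close> is continuous there.\<close>
  define d where "d = min r c"
  have d: "d \<in> einterval a b" using r c by (auto simp: d_def min_def)
  have d0: "0 < d" "d \<le> c" using d a0 by (auto simp: einterval_iff d_def)
  have memI: "t \<in> einterval a b" if "0 < t" "t \<le> c" for t
    using c that a0 by (auto simp: einterval_iff intro: le_less_trans[of "ereal t" "ereal c"])
  have cont: "continuous_on S (\<lambda>t. 1 / P t)" if "S \<subseteq> einterval a b" for S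
    by (rule continuous_on_subset[OF _ that]) (intro continuous_intros P_cont, use P_pos in force)
  have nn: "0 \<le> 1 / P t" if "t \<in> einterval a b" for t using P_pos[OF that] by simp
  define K where "K = integral {d..c} (\<lambda>t. 1 / P t)"
  have dc: "{d..c} \<subseteq> einterval a b" using memI d0 by auto
  have intK: "(\<lambda>t. 1 / P t) integrable_on {d..c}" by (intro integrable_continuous_interval cont dc)
  have K: "(\<integral>\<^sup>+t. ennreal (1 / P t) * indicator {d..c} t \<partial>lborel) = ennreal K"
    unfolding K_def
    by (rule nn_integral_has_integral_lebesgue'[OF _ integrable_integral[OF intK]], rule nn) (use dc in blast)
  have L: "(\<integral>\<^sup>+t. ennreal (1 / P t) * indicator {l..d} t \<partial>lborel) \<le> ennreal (y d / m)" if l: "0 < l" "l < d" for l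
  proof -
    have ld: "{l..d} \<subseteq> einterval a b" using memI l d0 by auto
    have int: "(\<lambda>t. 1 / P t) integrable_on {l..d}" by (intro integrable_continuous_interval cont ld)
    have "((\<lambda>t. z t / P t) has_integral (y d - y l)) {l..d}"
      by (rule FTC_real) (use l ld sol in \<open>auto simp: solution_def\<close>)
    then have "m * integral {l..d} (\<lambda>t. 1 / P t) \<le> y d - y l"
    proof (rule has_integral_le[OF has_integral_mult_right[OF integrable_integral[OF int]]])
      fix t assume t: "t \<in> {l..d}"
      then have tI: "t \<in> einterval a b" using ld by auto
      have "m \<le> z t" unfolding m_def
        by (rule solution_z_nonincreasing[OF sol pos tI r]) (use t in \<open>auto simp: d_def\<close>)
      then show "m * (1 / P t) \<le> z t / P t" using P_pos[OF tI] by (simp add: divide_right_mono)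
    qed
    also have "y d - y l \<le> y d" using pos[of l] memI l d0 by (simp add: less_imp_le)
    finally have "integral {l..d} (\<lambda>t. 1 / P t) \<le> y d / m" using m by (simp add: pos_le_divide_eq mult.commute)
    moreover have "(\<integral>\<^sup>+t. ennreal (1 / P t) * indicator {l..d} t \<partial>lborel) = ennreal (integral {l..d} (\<lambda>t. 1 / P t))"
      by (rule nn_integral_has_integral_lebesgue'[OF _ integrable_integral[OF int]], rule nn) (use ld in blast)
    ultimately show ?thesis by (simp add: ennreal_leI)
  qed
  have [measurable]: "(\<lambda>t. ennreal (1 / P t) * indicator S t) \<in> borel_measurable borel"
    if [measurable]: "S \<in> sets borel" "S \<subseteq> einterval a b" for S
    by (intro ennreal_indicator_continuous_measurable cont that)
  have sub: "{0<..<c} \<subseteq> einterval a b" using memI by auto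
  have "(\<integral>\<^sup>+t. (ennreal (1 / P t) * indicator {0<..<c} t) * indicator {0<..} t \<partial>lborel) \<le> ennreal (y d / m) + ennreal K"
  proof (rule nn_integral_le_truncated)
    show "(\<lambda>t. ennreal (1 / P t) * indicator {0<..<c} t) \<in> borel_measurable borel" using sub by measurable
    fix \<epsilon> :: real assume "0 < \<epsilon>"
    define l where "l = min \<epsilon> (d / 2)"
    have l: "0 < l" "l < d" "l \<le> \<epsilon>" using \<open>0 < \<epsilon>\<close> d0 by (auto simp: l_def min_def)
    have ld: "{l..d} \<subseteq> einterval a b" using memI l d0 by auto
    have "(\<integral>\<^sup>+t. ennreal (1 / P t) * indicator {0<..<c} t * indicator {\<epsilon><..} t \<partial>lborel)
      \<le> (\<integral>\<^sup>+t. ennreal (1 / P t) * indicator {l..d} t + ennreal (1 / P t) * indicator {d..c} t \<partial>lborel)"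
      using l by (intro nn_integral_mono) (auto split: split_indicator)
    also have "\<dots> = (\<integral>\<^sup>+t. ennreal (1 / P t) * indicator {l..d} t \<partial>lborel) + (\<integral>\<^sup>+t. ennreal (1 / P t) * indicator {d..c} t \<partial>lborel)"
      using ld dc by (intro nn_integral_add) measurable
    also have "\<dots> \<le> ennreal (y d / m) + ennreal K" unfolding K by (intro add_right_mono L l)
    finally show "(\<integral>\<^sup>+t. ennreal (1 / P t) * indicator {0<..<c} t * indicator {\<epsilon><..} t \<partial>lborel) \<le> ennreal (y d / m) + ennreal K" .
  qed
  also have "\<dots> < \<infinity>" by simp
  also have "(\<integral>\<^sup>+t. (ennreal (1 / P t) * indicator {0<..<c} t) * indicator {0<..} t \<partial>lborel)
     = (\<integral>\<^sup>+r\<in>{0<..<c}. ennreal (1 / P r) \<partial>lborel)"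
    by (intro nn_integral_cong) (auto split: split_indicator)
  finally show False using inf by simp
qed

text \<open>The boundary term \<open>(z / y) * f\<^sup>2\<close> has the right sign at the left end, so no decay of it
  at \<open>0\<close> is needed.\<close>

lemma hardy_truncated:
  assumes sol: "solution y z" and pos: "\<And>r. r \<in> einterval a b \<Longrightarrow> 0 < y r"
    and z: "\<And>r. r \<in> einterval a b \<Longrightarrow> z r \<le> 0"
    and df: "\<And>r. r \<in> einterval a b \<Longrightarrow> (f has_real_derivative f' r) (at r)"
    and cf': "continuous_on (einterval a b) f'"
    and lh: "l \<in> einterval a b" "h \<in> einterval a b" "l \<le> h" and fh: "f h = 0"
  shows "integral {l..h} (\<lambda>r. Q r * (f r)\<^sup>2) \<le> integral {l..h} (\<lambda>r. P r * (f' r)\<^sup>2)"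
proof -
  have sub: "{l..h} \<subseteq> einterval a b" by (rule Icc_subset[OF lh(1,2)])
  define w where "w r = z r / y r * (f r)\<^sup>2" for r
  define w' where "w' r = - Q r * (f r)\<^sup>2 - (z r)\<^sup>2 / (P r * (y r)\<^sup>2) * (f r)\<^sup>2 + 2 * (z r / y r) * f r * f' r" for r
  have dw: "(w has_real_derivative w' r) (at r)" if r: "r \<in> einterval a b" for r
  proof -
    have D: "(y has_real_derivative z r / P r) (at r)" "(z has_real_derivative - Q r * y r) (at r)"
      using sol r by (auto simp: solution_def)
    have nz: "y r \<noteq> 0" "P r \<noteq> 0" using pos[OF r] P_pos[OF r] by auto
    from DERIV_mult[OF DERIV_divide[OF D(2,1) nz(1)] DERIV_power[OF df[OF r], of 2]]
    have "(w has_real_derivative (- Q r * y r * y r - z r * (z r / P r)) / (y r * y r) * (f r)\<^sup>2 +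
      real 2 * (f' r * f r ^ (2 - Suc 0)) * (z r / y r)) (at r)"
      by (simp add: w_def[abs_def])
    moreover have "(- Q r * y r * y r - z r * (z r / P r)) / (y r * y r) * (f r)\<^sup>2 +
      real 2 * (f' r * f r ^ (2 - Suc 0)) * (z r / y r) = w' r"
      using nz by (simp add: w'_def field_simps power2_eq_square)
    ultimately show ?thesis by simp
  qed
  have w'_int: "(w' has_integral (w h - w l)) {l..h}"
    by (rule FTC_real[OF lh(3)]) (use dw sub in auto)
  have cf: "continuous_on {l..h} f"
    by (rule DERIV_continuous_on[where D = f'], rule has_field_derivative_at_within) (use df sub in auto)
  have c: "continuous_on {l..h} P" "continuous_on {l..h} Q" "continuous_on {l..h} f'"
    using P_cont Q_cont cf' sub continuous_on_subset by blast+
  have iQ: "(\<lambda>r. Q r * (f r)\<^sup>2) integrable_on {l..h}" and iP: "(\<lambda>r. P r * (f' r)\<^sup>2) integrable_on {l..h}"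
    by (intro integrable_continuous_interval continuous_intros c cf)+
  have "w h - w l \<le> integral {l..h} (\<lambda>r. P r * (f' r)\<^sup>2) - integral {l..h} (\<lambda>r. Q r * (f r)\<^sup>2)"
  proof (rule has_integral_le[OF w'_int has_integral_diff[OF integrable_integral[OF iP] integrable_integral[OF iQ]]])
    fix r assume "r \<in> {l..h}"
    then have r: "r \<in> einterval a b" using sub by auto
    have nz: "0 < y r" "0 < P r" using pos[OF r] P_pos[OF r] by auto
    have "P r * (f' r)\<^sup>2 - Q r * (f r)\<^sup>2 - w' r = P r * (f' r - z r / (P r * y r) * f r)\<^sup>2"
      using nz by (simp add: w'_def field_simps power2_eq_square)
    also have "0 \<le> \<dots>" using nz by simp
    finally show "w' r \<le> P r * (f' r)\<^sup>2 - Q r * (f r)\<^sup>2" by simp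
  qed
  moreover have "w h = 0" using fh by (simp add: w_def)
  moreover have "w l \<le> 0" using z[OF lh(1)] pos[OF lh(1)]
    by (simp add: w_def mult_nonpos_nonneg divide_nonpos_pos)
  ultimately show ?thesis by linarith
qed

text \<open>The truncated inequality is applied on \<open>{l..h}\<close>. Its right side is bounded
  by the full, possibly infinite, integral independently of \<open>l\<close>, and its left side
  increases to the full integral as \<open>l\<close> tends to 0.\<close>

lemma hardy_ray:
  assumes a0: "a = 0" and sol: "solution y z" and pos: "\<And>r. r \<in> einterval a b \<Longrightarrow> 0 < y r"
    and z: "\<And>r. r \<in> einterval a b \<Longrightarrow> z r \<le> 0"
    and df: "\<And>r. r \<in> einterval a b \<Longrightarrow> (f has_real_derivative f' r) (at r)"
    and cf': "continuous_on (einterval a b) f'"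
    and h: "h \<in> einterval a b" and fh: "\<And>r. h \<le> r \<Longrightarrow> f r = 0"
  shows "(\<integral>\<^sup>+r\<in>einterval a b. ennreal (Q r * (f r)\<^sup>2) \<partial>lborel) \<le>
    (\<integral>\<^sup>+r\<in>einterval a b. ennreal (P r * (f' r)\<^sup>2) \<partial>lborel)"
proof -
  have cf: "continuous_on (einterval a b) f"
    by (rule DERIV_continuous_on[where D = f'], rule has_field_derivative_at_within) (use df in auto)
  have meas: "(\<lambda>r. ennreal (Q r * (f r)\<^sup>2) * indicator (einterval a b) r) \<in> borel_measurable borel"
    by (intro ennreal_indicator_continuous_measurable borel_einterval continuous_intros Q_cont cf)
  have "(\<integral>\<^sup>+r. (ennreal (Q r * (f r)\<^sup>2) * indicator (einterval a b) r) * indicator {0<..} r \<partial>lborel) \<le>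
    (\<integral>\<^sup>+r\<in>einterval a b. ennreal (P r * (f' r)\<^sup>2) \<partial>lborel)"
  proof (rule nn_integral_le_truncated[OF meas])
    fix \<epsilon> :: real assume \<epsilon>: "0 < \<epsilon>"
    define l where "l = min \<epsilon> h"
    have h0: "0 < h" using h a0 by (simp add: einterval_iff)
    have l: "l \<in> einterval a b" "l \<le> h" "l \<le> \<epsilon>"
      using h h0 \<epsilon> a0 by (auto simp: l_def min_def einterval_iff intro: le_less_trans[of _ "ereal h"])
    have sub: "{l..h} \<subseteq> einterval a b" by (rule Icc_subset[OF l(1) h])
    have c: "continuous_on {l..h} P" "continuous_on {l..h} Q" "continuous_on {l..h} f'" "continuous_on {l..h} f"
      using P_cont Q_cont cf' cf sub continuous_on_subset by blast+
    have iQ: "(\<lambda>r. Q r * (f r)\<^sup>2) integrable_on {l..h}" and iP: "(\<lambda>r. P r * (f' r)\<^sup>2) integrable_on {l..h}"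
      by (intro integrable_continuous_interval continuous_intros c)+
    have nn: "0 \<le> Q r" "0 \<le> P r" if "r \<in> {l..h}" for r using sub that Q_pos P_pos by (auto simp: less_imp_le subset_iff)
    have "(\<integral>\<^sup>+r. ennreal (Q r * (f r)\<^sup>2) * indicator (einterval a b) r * indicator {\<epsilon><..} r \<partial>lborel)
      \<le> (\<integral>\<^sup>+r. ennreal (Q r * (f r)\<^sup>2) * indicator {l..h} r \<partial>lborel)"
      using l fh by (intro nn_integral_mono) (auto split: split_indicator)
    also have "\<dots> = ennreal (integral {l..h} (\<lambda>r. Q r * (f r)\<^sup>2))"
      by (rule nn_integral_has_integral_lebesgue'[OF _ integrable_integral[OF iQ]]) (use nn in simp)
    also have "\<dots> \<le> ennreal (integral {l..h} (\<lambda>r. P r * (f' r)\<^sup>2))"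
      by (intro ennreal_leI hardy_truncated[OF sol pos z df cf' l(1) h l(2)] fh) auto
    also have "\<dots> = (\<integral>\<^sup>+r. ennreal (P r * (f' r)\<^sup>2) * indicator {l..h} r \<partial>lborel)"
      by (rule nn_integral_has_integral_lebesgue'[OF _ integrable_integral[OF iP], symmetric]) (use nn in simp)
    also have "\<dots> \<le> (\<integral>\<^sup>+r\<in>einterval a b. ennreal (P r * (f' r)\<^sup>2) \<partial>lborel)"
      using sub by (intro nn_integral_mono) (auto split: split_indicator)
    finally show "(\<integral>\<^sup>+r. ennreal (Q r * (f r)\<^sup>2) * indicator (einterval a b) r * indicator {\<epsilon><..} r \<partial>lborel) \<le>
      (\<integral>\<^sup>+r\<in>einterval a b. ennreal (P r * (f' r)\<^sup>2) \<partial>lborel)" .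
  qed
  also have "(\<integral>\<^sup>+r. (ennreal (Q r * (f r)\<^sup>2) * indicator (einterval a b) r) * indicator {0<..} r \<partial>lborel) =
    (\<integral>\<^sup>+r\<in>einterval a b. ennreal (Q r * (f r)\<^sup>2) \<partial>lborel)"
    using a0 by (intro nn_integral_cong) (auto simp: einterval_iff split: split_indicator)
  finally show ?thesis .
qed

end

subsection \<open>Radial test functions\<close>

lemma gradient_eqI: "(u has_derivative (\<lambda>h. h \<bullet> D)) (at x) \<Longrightarrow> gradient u x = D"
  unfolding gradient_def gderiv_def
proof (rule the_equality)
  fix E assume "(u has_derivative (\<lambda>h. h \<bullet> D)) (at x)" "(u has_derivative (\<lambda>h. h \<bullet> E)) (at x)"
  then have "(\<lambda>h. h \<bullet> D) = (\<lambda>h. h \<bullet> E)" by (rule has_derivative_unique)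
  from fun_cong[OF this, of "D - E"] have "(D - E) \<bullet> (D - E) = 0" by (simp add: inner_diff_right)
  then show "E = D" by simp
qed

section \<open>Closure properties of C^k functions\<close>

lemma Ck_on_const: "Ck_on k UNIV (\<lambda>_::'a::euclidean_space. c)"
proof (induction k arbitrary: c)
  case (Suc k)
  have "frechet_derivative (\<lambda>_::'a. c) (at x) h = 0" for x h
    by (simp add: frechet_derivative_at[OF has_derivative_const, symmetric])
  then show ?case using Suc by simp
qed simp

lemma Ck_on_SucI:
  assumes "\<And>x. (f has_derivative D x) (at x)" "\<And>h. Ck_on k UNIV (\<lambda>x. D x h)"
  shows "Ck_on (Suc k) UNIV f"
proof -
  have "frechet_derivative f (at x) = D x" for x
    by (rule frechet_derivative_at[OF assms(1), symmetric])
  then show ?thesis using assms by (auto simp: differentiable_def)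
qed

lemma Ck_on_Suc_has_derivative:
  "Ck_on (Suc k) UNIV f \<Longrightarrow> (f has_derivative frechet_derivative f (at x)) (at x)"
  by (simp add: frechet_derivative_works)

lemma Ck_on_SucD: "Ck_on (Suc k) UNIV f \<Longrightarrow> Ck_on k UNIV f"
proof (induction k arbitrary: f)
  case 0
  then show ?case
    by (auto intro!: differentiable_imp_continuous_on simp: differentiable_on_def intro: differentiable_at_withinI)
next
  case (Suc k)
  have "Ck_on k UNIV (\<lambda>x. frechet_derivative f (at x) h)" for h
    by (rule Suc.IH) (use Suc.prems in simp)
  then show ?case using Suc.prems by simp
qed

lemma Ck_on_add: "Ck_on k UNIV f \<Longrightarrow> Ck_on k UNIV g \<Longrightarrow> Ck_on k UNIV (\<lambda>x. f x + g x)"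
proof (induction k arbitrary: f g)
  case 0 then show ?case by (auto intro: continuous_on_add)
next
  case (Suc k)
  show ?case
    by (rule Ck_on_SucI, rule has_derivative_add[OF Suc.prems[THEN Ck_on_Suc_has_derivative]])
      (rule Suc.IH; use Suc.prems in simp)
qed

lemma Ck_on_mult: "Ck_on k UNIV f \<Longrightarrow> Ck_on k UNIV g \<Longrightarrow> Ck_on k UNIV (\<lambda>x. f x * g x)"
proof (induction k arbitrary: f g)
  case 0 then show ?case by (auto intro: continuous_on_mult)
next
  case (Suc k)
  show ?case
    by (rule Ck_on_SucI, rule has_derivative_mult[OF Suc.prems[THEN Ck_on_Suc_has_derivative]])
      (intro Ck_on_add Suc.IH Suc.prems[THEN Ck_on_SucD]; use Suc.prems in simp)
qed

lemma Ck_on_inner: "Ck_on k UNIV (\<lambda>x. x \<bullet> h)"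
proof (cases k)
  case (Suc k')
  show ?thesis unfolding Suc
    by (rule Ck_on_SucI[where D = "\<lambda>_ v. v \<bullet> h"]) (auto intro!: Ck_on_const derivative_eq_intros)
qed (simp add: continuous_intros)

lemma has_derivative_inner_self:
  "((\<lambda>x. x \<bullet> x) has_derivative (\<lambda>h. 2 * (x \<bullet> h))) (at x)" for x :: "'a::euclidean_space"
  by (auto intro!: derivative_eq_intros simp: inner_commute)

text \<open>The whole family of successive derivatives is carried along because differentiating at
  index \<open>i\<close> produces index \<open>Suc i\<close> times a linear factor. The affine
  argument serves both factors of the bump, with \<open>c\<close> equal to 1 and -1.\<close>

lemma Ck_on_compose_norm_sq:
  fixes d :: "nat \<Rightarrow> real \<Rightarrow> real"
  assumes d: "\<And>i t. (d i has_real_derivative d (Suc i) t) (at t)"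
  shows "Ck_on k UNIV (\<lambda>x::'a::euclidean_space. d i (c * (x \<bullet> x) + e))"
proof (induction k arbitrary: i)
  case 0
  have "continuous_on UNIV (d i)"
    using d by (meson DERIV_continuous_on has_field_derivative_at_within)
  then show ?case by (auto intro!: continuous_intros continuous_on_compose2[of UNIV "d i"])
next
  case (Suc k)
  show ?case
  proof (rule Ck_on_SucI)
    fix x :: 'a
    have "((\<lambda>x. c * (x \<bullet> x) + e) has_derivative (\<lambda>h. c * (2 * (x \<bullet> h)))) (at x)"
      using has_derivative_add[OF has_derivative_mult_right[OF has_derivative_inner_self] has_derivative_const]
      by simp
    from has_derivative_compose[OF this d[unfolded has_field_derivative_def]]
    show "((\<lambda>x. d i (c * (x \<bullet> x) + e)) has_derivative (\<lambda>h. d (Suc i) (c * (x \<bullet> x) + e) * (c * (2 * (x \<bullet> h))))) (at x)" .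
  next
    show "Ck_on k UNIV (\<lambda>x::'a. d (Suc i) (c * (x \<bullet> x) + e) * (c * (2 * (x \<bullet> h))))" for h
      by (rule Ck_on_mult[OF Suc.IH Ck_on_mult[OF Ck_on_const Ck_on_mult[OF Ck_on_const Ck_on_inner]]])
  qed
qed

section \<open>A smooth function that is flat at 0\<close>

definition flat_poly :: "real poly \<Rightarrow> real \<Rightarrow> real" where
  "flat_poly q t = (if 0 < t then poly q (1 / t) * exp (- (1 / t)) else 0)"

lemma poly_exp_tendsto_0: "((\<lambda>x::real. poly q x * exp (- x)) \<longlongrightarrow> 0) at_top"
proof -
  have "((\<lambda>x. \<Sum>i\<le>degree q. coeff q i * (x ^ i / exp x)) \<longlongrightarrow> (\<Sum>i\<le>degree q. coeff q i * 0)) at_top"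
    by (intro tendsto_intros tendsto_power_div_exp_0)
  then show ?thesis
    by (simp add: poly_altdef sum_distrib_right exp_minus divide_inverse mult.assoc)
qed

lemma flat_poly_tendsto_0: "(flat_poly q \<longlongrightarrow> 0) (at 0)"
proof (rule filterlim_split_at)
  have "(flat_poly q \<longlongrightarrow> 0) (at_left 0) \<longleftrightarrow> ((\<lambda>_. 0::real) \<longlongrightarrow> 0) (at_left (0::real))"
    by (rule filterlim_cong) (auto simp: flat_poly_def eventually_at_left_field intro!: exI[of _ "-1"])
  then show "(flat_poly q \<longlongrightarrow> 0) (at_left 0)" by simp
  have "((\<lambda>t. poly q (inverse t) * exp (- (inverse t))) \<longlongrightarrow> 0) (at_right 0)"
    by (rule filterlim_compose[OF poly_exp_tendsto_0 filterlim_inverse_at_top_right])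
  moreover have "(flat_poly q \<longlongrightarrow> 0) (at_right 0) \<longleftrightarrow>
    ((\<lambda>t. poly q (inverse t) * exp (- (inverse t))) \<longlongrightarrow> 0) (at_right 0)"
    by (rule filterlim_cong) (auto simp: flat_poly_def eventually_at_right_field inverse_eq_divide intro!: exI[of _ "1"])
  ultimately show "(flat_poly q \<longlongrightarrow> 0) (at_right 0)" by simp
qed

text \<open>With x = 1/t, the derivative in t of q(x) exp(-x) is x^2 (q(x) - q'(x)) exp(-x), and
  \<open>[:0, 0, 1:]\<close> is x^2. At 0 the difference quotient multiplies q by x, so it stays in
  the same class and tends to 0.\<close>

lemma flat_poly_deriv:
  "(flat_poly q has_real_derivative flat_poly ([:0, 0, 1:] * (q - pderiv q)) t) (at t)"
proof -
  consider "t < 0" | "t = 0" | "0 < t" by linarith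
  then show ?thesis
  proof cases
    case 1
    have "((\<lambda>_. 0) has_real_derivative 0) (at t)" by simp
    then have "(flat_poly q has_real_derivative 0) (at t)"
      by (rule has_field_derivative_transform_within_open[of _ _ _ "{..<0}"]) (use 1 in \<open>auto simp: flat_poly_def\<close>)
    then show ?thesis using 1 by (simp add: flat_poly_def)
  next
    case 2
    have "(\<lambda>y. (flat_poly q y - flat_poly q 0) / (y - 0)) = flat_poly (pCons 0 q)"
      by (simp add: flat_poly_def fun_eq_iff)
    moreover have "flat_poly r 0 = 0" for r by (simp add: flat_poly_def)
    ultimately show ?thesis using flat_poly_tendsto_0[of "pCons 0 q"]
      unfolding 2 has_field_derivative_iff by simp
  next
    case 3
    have "((\<lambda>t. poly q (1 / t) * exp (- (1 / t))) has_real_derivative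
        flat_poly ([:0, 0, 1:] * (q - pderiv q)) t) (at t)"
      using 3 by (auto intro!: derivative_eq_intros poly_DERIV[THEN DERIV_chain2]
          simp: flat_poly_def field_simps power2_eq_square)
    then show ?thesis
      by (rule has_field_derivative_transform_within_open[of _ _ _ "{0<..}"]) (use 3 in \<open>auto simp: flat_poly_def\<close>)
  qed
qed

text \<open>\<open>flat 0\<close> is exp(-1/t) for t > 0 and 0 otherwise; \<open>flat i\<close> is
  its i-th derivative.\<close>

definition flat :: "nat \<Rightarrow> real \<Rightarrow> real" where
  "flat i = flat_poly (((\<lambda>q. [:0, 0, 1:] * (q - pderiv q)) ^^ i) 1)"

lemma flat_deriv: "(flat i has_real_derivative flat (Suc i) t) (at t)"
  unfolding flat_def funpow.simps o_def by (rule flat_poly_deriv)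

lemma flat_pos: "0 < t \<Longrightarrow> 0 < flat 0 t"
  by (simp add: flat_def flat_poly_def)

lemma flat_eq_0: "t \<le> 0 \<Longrightarrow> flat i t = 0"
  by (simp add: flat_def flat_poly_def)

definition bump :: "real \<Rightarrow> real \<Rightarrow> real \<Rightarrow> real" where
  "bump A B s = flat 0 (s - A) * flat 0 (B - s)"

definition bump' :: "real \<Rightarrow> real \<Rightarrow> real \<Rightarrow> real" where
  "bump' A B s = flat 1 (s - A) * flat 0 (B - s) - flat 0 (s - A) * flat 1 (B - s)"

lemma bump_deriv: "(bump A B has_real_derivative bump' A B s) (at s)"
proof -
  have "((\<lambda>s. flat 0 (s - A)) has_real_derivative flat 1 (s - A) * 1) (at s)"
    by (rule DERIV_chain2[where f = "flat 0" and g = "\<lambda>s. s - A"])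
      (use flat_deriv[of 0] in \<open>auto intro!: derivative_eq_intros\<close>)
  moreover have "((\<lambda>s. flat 0 (B - s)) has_real_derivative flat 1 (B - s) * -1) (at s)"
    by (rule DERIV_chain2[where f = "flat 0" and g = "\<lambda>s. B - s"])
      (use flat_deriv[of 0] in \<open>auto intro!: derivative_eq_intros\<close>)
  ultimately show ?thesis
    unfolding bump_def[abs_def] bump'_def using DERIV_mult by (fastforce simp: algebra_simps)
qed

lemma flat_cont: "continuous_on S (flat i)"
  using flat_deriv by (meson DERIV_continuous_on has_field_derivative_at_within)

lemma bump_cont: "continuous_on S (bump A B)" "continuous_on S (bump' A B)"
  unfolding bump_def[abs_def] bump'_def[abs_def]
  by (intro continuous_intros continuous_on_compose2[OF flat_cont[of UNIV]]; simp)+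

lemma bump_pos: "A < s \<Longrightarrow> s < B \<Longrightarrow> 0 < bump A B s"
  by (simp add: bump_def flat_pos)

lemma bump_eq_0: "s \<le> A \<or> B \<le> s \<Longrightarrow> bump A B s = 0 \<and> bump' A B s = 0"
  by (auto simp: bump_def bump'_def flat_eq_0)

text \<open>The bump fixes the support and the polynomial supplies density. Both take |x|^2 as
  argument, hence smoothness also at the origin.\<close>

definition radial_test :: "real poly \<Rightarrow> real \<Rightarrow> real \<Rightarrow> 'a::euclidean_space \<Rightarrow> real" where
  "radial_test p A B x = poly p (x \<bullet> x) * bump A B (x \<bullet> x)"

lemma Ck_on_poly_norm_sq: "Ck_on k UNIV (\<lambda>x::'a::euclidean_space. poly p (x \<bullet> x))"
proof (induction p)
  case 0 then show ?case by (simp add: Ck_on_const)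
next
  case (pCons a p)
  have "Ck_on k UNIV (\<lambda>x::'a. x \<bullet> x)"
  proof (cases k)
    case (Suc k')
    show ?thesis unfolding Suc
      by (rule Ck_on_SucI[OF has_derivative_inner_self])
        (intro Ck_on_mult Ck_on_const Ck_on_inner)
  qed (auto intro!: continuous_intros)
  then show ?case using pCons by (auto intro!: Ck_on_add Ck_on_mult Ck_on_const)
qed

lemma radial_test_mem:
  assumes "0 < A" "A < B" "ereal (sqrt B) < R"
  shows "(radial_test p A B :: 'a::euclidean_space \<Rightarrow> real) \<in> test_functions (ball0 R)"
proof -
  have "Ck_on k UNIV (radial_test p A B :: 'a \<Rightarrow> real)" for k
  proof -
    have "Ck_on k UNIV (\<lambda>x::'a. poly p (x \<bullet> x) * (flat 0 (1 * (x \<bullet> x) + - A) * flat 0 (- 1 * (x \<bullet> x) + B)))"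
      by (intro Ck_on_mult Ck_on_poly_norm_sq Ck_on_compose_norm_sq flat_deriv)
    then show ?thesis by (simp add: radial_test_def[abs_def] bump_def)
  qed
  moreover have sub: "closure {x::'a. radial_test p A B x \<noteq> 0} \<subseteq> cball 0 (sqrt B)"
  proof (rule closure_minimal)
    show "{x::'a. radial_test p A B x \<noteq> 0} \<subseteq> cball 0 (sqrt B)"
    proof
      fix x :: 'a assume "x \<in> {x. radial_test p A B x \<noteq> 0}"
      then have "bump A B (x \<bullet> x) \<noteq> 0" by (simp add: radial_test_def)
      then have "x \<bullet> x \<le> B" using bump_eq_0[of "x \<bullet> x" A B] by linarith
      then have "norm x \<le> sqrt B" by (simp add: norm_eq_sqrt_inner)
      then show "x \<in> cball 0 (sqrt B)" by simp
    qed
  qed simp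
  moreover have "cball 0 (sqrt B) \<subseteq> (ball0 R :: 'a set)"
    using assms(3) by (auto simp: ball0_def intro: le_less_trans[rotated])
  moreover have "compact (closure {x::'a. radial_test p A B x \<noteq> 0})"
    using sub by (meson bounded_cball bounded_subset closed_closure compact_eq_bounded_closed)
  ultimately show ?thesis by (auto simp: test_functions_def)
qed

definition radial_test_deriv :: "real poly \<Rightarrow> real \<Rightarrow> real \<Rightarrow> real \<Rightarrow> real" where
  "radial_test_deriv p A B r =
     2 * r * (poly (pderiv p) (r\<^sup>2) * bump A B (r\<^sup>2) + poly p (r\<^sup>2) * bump' A B (r\<^sup>2))"

lemma norm_gradient_radial_test:
  "(norm (gradient (radial_test p A B) x))\<^sup>2 = (radial_test_deriv p A B (norm x))\<^sup>2"
  for x :: "'a::euclidean_space"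
proof -
  define D where "D = poly (pderiv p) (x \<bullet> x) * bump A B (x \<bullet> x) + poly p (x \<bullet> x) * bump' A B (x \<bullet> x)"
  have "((\<lambda>s. poly p s * bump A B s) has_real_derivative D) (at (x \<bullet> x))"
    unfolding D_def using DERIV_mult[OF poly_DERIV bump_deriv] by (simp add: add.commute mult.commute)
  from has_derivative_compose[OF has_derivative_inner_self this[unfolded has_field_derivative_def]]
  have "(radial_test p A B has_derivative (\<lambda>h. h \<bullet> ((2 * D) *\<^sub>R x))) (at x)"
    by (simp add: radial_test_def[abs_def] inner_commute mult_ac)
  then have "gradient (radial_test p A B) x = (2 * D) *\<^sub>R x" by (rule gradient_eqI)
  moreover have "radial_test_deriv p A B (norm x) = 2 * norm x * D"
    by (simp add: radial_test_deriv_def D_def dot_square_norm)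
  ultimately show ?thesis by (simp add: power_mult_distrib)
qed

text \<open>Weierstrass approximation is applied to \<open>g'\<close>; the polynomial is then
  integrated coefficientwise, with the constant chosen so that \<open>p\<close> and \<open>g\<close>
  agree at \<open>A\<close>. The mean value inequality transfers the error to
  \<open>g\<close>.\<close>

lemma polynomial_C1_approximation:
  fixes g g' :: "real \<Rightarrow> real"
  assumes D: "\<And>s. s \<in> {A..B} \<Longrightarrow> (g has_real_derivative g' s) (at s within {A..B})"
    and cont: "continuous_on {A..B} g'" and AB: "A \<le> B" and e: "0 < e"
  shows "\<exists>p. \<forall>s\<in>{A..B}. \<bar>poly p s - g s\<bar> < e \<and> \<bar>poly (pderiv p) s - g' s\<bar> < e"
proof -
  \<comment> \<open>Small enough for the derivative itself and, after multiplication by the length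
    \<open>B - A\<close>, for the function.\<close>
  define d where "d = e / (1 + B - A)"
  have d: "0 < d" "d * (B - A) < e" "d \<le> e" using e AB by (auto simp: d_def field_simps)
  obtain q where q: "real_polynomial_function q" "\<And>x. x \<in> {A..B} \<Longrightarrow> \<bar>g' x - q x\<bar> < d"
    using Stone_Weierstrass_real_polynomial_function[OF compact_Icc cont d(1)] by metis
  then obtain a n where qa: "q = (\<lambda>x. \<Sum>i\<le>n. a i * x ^ i)"
    unfolding real_polynomial_function_iff_sum by blast
  define p0 where "p0 = (\<Sum>i\<le>n. monom (a i / real (Suc i)) (Suc i))"
  define p where "p = p0 + [:g A - poly p0 A:]"
  have "poly (pderiv (\<Sum>i\<le>n. monom (a i / real (Suc i)) (Suc i))) s = (\<Sum>i\<le>n. a i * s ^ i)" for s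
    by (induction n) (simp_all add: pderiv_add pderiv_monom poly_monom del: of_nat_Suc)
  then have "poly (pderiv p) s = q s" for s
    by (simp add: p_def p0_def pderiv_add pderiv_pCons qa)
  then have dq: "\<bar>poly (pderiv p) s - g' s\<bar> < d" if "s \<in> {A..B}" for s
    using q(2)[OF that] by (simp add: abs_minus_commute)
  have pA: "poly p A = g A" by (simp add: p_def)
  have "\<bar>poly p s - g s\<bar> < e" if s: "s \<in> {A..B}" for s
  proof -
    have "norm ((poly p s - g s) - (poly p A - g A)) \<le> d * norm (s - A)"
    proof (rule field_differentiable_bound[where S = "{A..B}" and f = "\<lambda>s. poly p s - g s" and f' = "\<lambda>s. poly (pderiv p) s - g' s"])
      show "((\<lambda>s. poly p s - g s) has_real_derivative poly (pderiv p) z - g' z) (at z within {A..B})" if "z \<in> {A..B}" for z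
        by (intro DERIV_diff D that has_field_derivative_at_within[OF poly_DERIV])
      show "norm (poly (pderiv p) z - g' z) \<le> d" if "z \<in> {A..B}" for z
        using dq[OF that] by simp
    qed (use s in auto)
    also have "\<dots> \<le> d * (B - A)" using s d by (intro mult_left_mono) auto
    finally show ?thesis using d(2) pA by simp
  qed
  then show ?thesis using dq d(3) by (intro exI[of _ p]) force
qed

text \<open>A C^1 profile is written as f(r) = g(r^2) bump(r^2). Approximating g in C^1 by
  polynomials makes the integrands of the form converge uniformly, so nonnegativity passes to the
  limit.\<close>

lemma nonneg_form_approximation:
  fixes f f' P Q :: "real \<Rightarrow> real"
  assumes lo: "0 < lo" "lo < l" "l < u" "u < hi"
    and cP: "continuous_on {lo..hi} P" and cQ: "continuous_on {lo..hi} Q"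
    and df: "\<And>r. (f has_real_derivative f' r) (at r)" and cf': "continuous_on UNIV f'"
    and f0: "\<And>r. r \<notin> {l..u} \<Longrightarrow> f r = 0 \<and> f' r = 0"
    and form: "\<And>p. 0 \<le> integral {lo..hi} (\<lambda>r. P r * (radial_test_deriv p (lo\<^sup>2) (hi\<^sup>2) r)\<^sup>2 -
       Q r * (poly p (r\<^sup>2) * bump (lo\<^sup>2) (hi\<^sup>2) (r\<^sup>2))\<^sup>2)"
  shows "0 \<le> integral {lo..hi} (\<lambda>r. P r * (f' r)\<^sup>2 - Q r * (f r)\<^sup>2)"
proof -
  define A where "A = lo\<^sup>2"
  define B where "B = hi\<^sup>2"
  have AB: "0 < A" "A < B" using lo by (auto simp: A_def B_def intro: power_strict_mono)
  let ?c = "bump A B" and ?c' = "bump' A B"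
  define g where "g s = f (sqrt s) / ?c s" for s
  define g' where "g' s = (f' (sqrt s) / (2 * sqrt s) * ?c s - f (sqrt s) * ?c' s) / (?c s)\<^sup>2" for s
  \<comment> \<open>On this neighbourhood of the ends \<open>f (sqrt s)\<close> vanishes, so
    \<open>g\<close> and \<open>g'\<close> are 0 there, even at \<open>A\<close> and
    \<open>B\<close>, where the bump vanishes and the quotient is 0 / 0 = 0. Elsewhere on the
    interval the bump is positive.\<close>
  define U where "U = {s. s < l\<^sup>2 \<or> u\<^sup>2 < s}"
  have openU: "open U" unfolding U_def by (intro open_Collect_disj open_Collect_less continuous_intros)
  have U0: "f (sqrt s) = 0 \<and> f' (sqrt s) = 0" if "s \<in> U" for s
  proof (rule f0)
    have "sqrt s < l \<or> u < sqrt s"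
      using that lo unfolding U_def by (auto intro: real_less_rsqrt real_less_lsqrt simp: real_sqrt_less_iff)
    then show "sqrt s \<notin> {l..u}" by auto
  qed
  have cover: "s \<in> U \<or> A < s \<and> s < B" if "s \<in> {A..B}" for s
  proof -
    have "A < l\<^sup>2" "u\<^sup>2 < B" using lo by (auto simp: A_def B_def intro!: power_strict_mono)
    then show ?thesis using that by (auto simp: U_def)
  qed
  have c0: "?c s \<noteq> 0" if "A < s" "s < B" for s using bump_pos[OF that] by simp
  have cf: "continuous_on UNIV f"
    using df by (meson DERIV_continuous_on has_field_derivative_at_within)
  have dg: "(g has_real_derivative g' s) (at s within {A..B})" if s: "s \<in> {A..B}" for s
  proof -
    consider "s \<in> U" | "A < s" "s < B" using cover[OF s] by blast
    then have "(g has_real_derivative g' s) (at s)"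
    proof cases
      case 1
      have "((\<lambda>_. 0) has_real_derivative 0) (at s)" by simp
      then have "(g has_real_derivative 0) (at s)"
        by (rule has_field_derivative_transform_within_open[OF _ openU 1]) (simp add: g_def U0)
      then show ?thesis using U0[OF 1] by (simp add: g'_def)
    next
      case 2
      have "(sqrt has_real_derivative inverse (sqrt s) / 2) (at s)"
        using 2 AB by (intro DERIV_real_sqrt) auto
      then have "((\<lambda>s. f (sqrt s)) has_real_derivative f' (sqrt s) * (inverse (sqrt s) / 2)) (at s)"
        by (rule DERIV_chain2[OF df])
      moreover have "f' (sqrt s) * (inverse (sqrt s) / 2) = f' (sqrt s) / (2 * sqrt s)"
        by (simp add: field_simps)
      ultimately have "((\<lambda>s. f (sqrt s)) has_real_derivative f' (sqrt s) / (2 * sqrt s)) (at s)" by (simp only:)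
      from DERIV_divide[OF this bump_deriv[of A B s] c0[OF 2]]
      show ?thesis unfolding g_def[abs_def] g'_def power2_eq_square .
    qed
    then show ?thesis by (rule has_field_derivative_at_within)
  qed
  have cg': "continuous_on {A..B} g'"
  proof -
    have "continuous_on (U \<union> {A<..<B}) g'"
    proof (rule continuous_on_open_Un[OF openU])
      show "continuous_on U g'"
        by (rule continuous_on_eq[OF continuous_on_const[of _ 0]]) (simp add: g'_def U0)
      show "continuous_on {A<..<B} g'"
        unfolding g'_def[abs_def]
        by (intro continuous_intros bump_cont continuous_on_compose2[OF cf] continuous_on_compose2[OF cf'])
          (use AB c0 in \<open>auto\<close>)
    qed simp
    then show ?thesis by (rule continuous_on_subset) (rule subsetI, drule cover, auto)
  qed
  have cg: "continuous_on {A..B} g" using dg by (meson DERIV_continuous_on)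
  have ex: "\<exists>p. \<forall>s\<in>{A..B}. \<bar>poly p s - g s\<bar> < 1 / real (Suc k) \<and> \<bar>poly (pderiv p) s - g' s\<bar> < 1 / real (Suc k)" for k
    by (rule polynomial_C1_approximation[OF dg cg']) (use AB in auto)
  then obtain p where p: "\<And>k s. s \<in> {A..B} \<Longrightarrow> \<bar>poly (p k) s - g s\<bar> < 1 / real (Suc k)"
    "\<And>k s. s \<in> {A..B} \<Longrightarrow> \<bar>poly (pderiv (p k)) s - g' s\<bar> < 1 / real (Suc k)"
    by metis
  have unif: "uniform_limit {A..B} h h' sequentially"
    if "\<And>k s. s \<in> {A..B} \<Longrightarrow> \<bar>h k s - h' s\<bar> < 1 / real (Suc k)" for h :: "nat \<Rightarrow> real \<Rightarrow> real" and h' :: "real \<Rightarrow> real"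
  proof (rule uniform_limitI)
    fix e :: real assume "0 < e"
    then obtain N where N: "1 / real (Suc N) < e" using nat_approx_posE by blast
    show "\<forall>\<^sub>F n in sequentially. \<forall>x\<in>{A..B}. dist (h n x) (h' x) < e"
      unfolding eventually_sequentially
    proof (intro exI[of _ N] allI impI ballI)
      fix n x assume "N \<le> n" "x \<in> {A..B}"
      then have "\<bar>h n x - h' x\<bar> < 1 / real (Suc n)" "1 / real (Suc n) \<le> 1 / real (Suc N)"
        using that by (auto simp: frac_le)
      then show "dist (h n x) (h' x) < e" using N by (simp add: dist_real_def)
    qed
  qed
  have sq: "(\<lambda>r. r\<^sup>2) \<in> {lo..hi} \<rightarrow> {A..B}"
    using lo by (auto simp: A_def B_def intro!: power_mono)
  have u1: "uniform_limit {lo..hi} (\<lambda>k r. poly (p k) (r\<^sup>2)) (\<lambda>r. g (r\<^sup>2)) sequentially"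
    by (rule uniform_limit_compose'[OF unif[OF p(1)] sq])
  have u2: "uniform_limit {lo..hi} (\<lambda>k r. poly (pderiv (p k)) (r\<^sup>2)) (\<lambda>r. g' (r\<^sup>2)) sequentially"
    by (rule uniform_limit_compose'[OF unif[OF p(2)] sq])
  have bdd: "bounded (h ` {lo..hi})" if "continuous_on {lo..hi} h" for h :: "real \<Rightarrow> real"
    using compact_continuous_image[OF that compact_Icc] by (rule compact_imp_bounded)
  have cgr: "continuous_on {lo..hi} (\<lambda>r. g (r\<^sup>2))" "continuous_on {lo..hi} (\<lambda>r. g' (r\<^sup>2))"
    by (rule continuous_on_compose2[OF cg] continuous_on_compose2[OF cg'], use sq in \<open>auto intro!: continuous_intros\<close>)+
  have cbr: "continuous_on {lo..hi} (\<lambda>r. ?c (r\<^sup>2))" "continuous_on {lo..hi} (\<lambda>r. ?c' (r\<^sup>2))"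
    by (rule continuous_on_compose2[OF bump_cont(1)[of UNIV]] continuous_on_compose2[OF bump_cont(2)[of UNIV]],
        auto intro!: continuous_intros)+
  have cpr: "continuous_on {lo..hi} (\<lambda>r. poly q (r\<^sup>2))" for q :: "real poly"
    by (intro continuous_intros)
  have "uniform_limit {lo..hi}
    (\<lambda>k r. P r * (2 * r * (poly (pderiv (p k)) (r\<^sup>2) * ?c (r\<^sup>2) + poly (p k) (r\<^sup>2) * ?c' (r\<^sup>2)))\<^sup>2
       - Q r * (poly (p k) (r\<^sup>2) * ?c (r\<^sup>2))\<^sup>2)
    (\<lambda>r. P r * (2 * r * (g' (r\<^sup>2) * ?c (r\<^sup>2) + g (r\<^sup>2) * ?c' (r\<^sup>2)))\<^sup>2
       - Q r * (g (r\<^sup>2) * ?c (r\<^sup>2))\<^sup>2) sequentially"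
    \<comment> \<open>Only squares of products are expanded; \<open>r\<^sup>2\<close> stays intact
      so that \<open>u1\<close> and \<open>u2\<close> still match.\<close>
    unfolding power2_eq_square[of "_ * _"]
    by (intro uniform_limit_minus uniform_limit_add uniform_lim_mult uniform_limit_const u1 u2 bdd
        continuous_intros cP cQ cgr cbr)
  moreover have "continuous_on {lo..hi} (\<lambda>r. P r * (2 * r * (poly (pderiv (p k)) (r\<^sup>2) * ?c (r\<^sup>2) + poly (p k) (r\<^sup>2) * ?c' (r\<^sup>2)))\<^sup>2
       - Q r * (poly (p k) (r\<^sup>2) * ?c (r\<^sup>2))\<^sup>2)" for k
    by (intro continuous_intros cP cQ cbr)
  ultimately obtain I J where IJ:
    "\<And>k. ((\<lambda>r. P r * (2 * r * (poly (pderiv (p k)) (r\<^sup>2) * ?c (r\<^sup>2) + poly (p k) (r\<^sup>2) * ?c' (r\<^sup>2)))\<^sup>2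
       - Q r * (poly (p k) (r\<^sup>2) * ?c (r\<^sup>2))\<^sup>2) has_integral I k) {lo..hi}"
    "((\<lambda>r. P r * (2 * r * (g' (r\<^sup>2) * ?c (r\<^sup>2) + g (r\<^sup>2) * ?c' (r\<^sup>2)))\<^sup>2
       - Q r * (g (r\<^sup>2) * ?c (r\<^sup>2))\<^sup>2) has_integral J) {lo..hi}" "I \<longlonglongrightarrow> J"
    by (rule uniform_limit_integral) auto
  have "0 \<le> I k" for k
    using form[of "p k"] integral_unique[OF IJ(1)] by (simp add: radial_test_deriv_def A_def B_def)
  then have "0 \<le> J" using IJ(3) by (intro LIMSEQ_le_const) auto
  also have "J = integral {lo..hi} (\<lambda>r. P r * (2 * r * (g' (r\<^sup>2) * ?c (r\<^sup>2) + g (r\<^sup>2) * ?c' (r\<^sup>2)))\<^sup>2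
       - Q r * (g (r\<^sup>2) * ?c (r\<^sup>2))\<^sup>2)"
    using IJ(2) by (rule integral_unique[symmetric])
  also have "\<dots> = integral {lo..hi} (\<lambda>r. P r * (f' r)\<^sup>2 - Q r * (f r)\<^sup>2)"
  proof (rule integral_cong)
    fix r assume r: "r \<in> {lo..hi}"
    have rpos: "0 < r" using r lo by auto
    have "g (r\<^sup>2) * ?c (r\<^sup>2) = f r \<and> 2 * r * (g' (r\<^sup>2) * ?c (r\<^sup>2) + g (r\<^sup>2) * ?c' (r\<^sup>2)) = f' r"
    proof (cases "r = lo \<or> r = hi")
      case True
      then have "?c (r\<^sup>2) = 0 \<and> ?c' (r\<^sup>2) = 0" by (intro bump_eq_0) (auto simp: A_def B_def)
      then show ?thesis using f0[of r] True lo by auto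
    next
      case False
      then have "A < r\<^sup>2" "r\<^sup>2 < B" using r lo by (auto simp: A_def B_def intro!: power_strict_mono)
      from c0[OF this] show ?thesis
        using rpos by (simp add: g_def g'_def field_simps power2_eq_square)
    qed
    then show "P r * (2 * r * (g' (r\<^sup>2) * ?c (r\<^sup>2) + g (r\<^sup>2) * ?c' (r\<^sup>2)))\<^sup>2 - Q r * (g (r\<^sup>2) * ?c (r\<^sup>2))\<^sup>2 =
      P r * (f' r)\<^sup>2 - Q r * (f r)\<^sup>2" by simp
  qed
  finally show ?thesis .
qed

subsection \<open>Polar coordinates\<close>

lemma nn_integral_scaleR:
  fixes f :: "'a::euclidean_space \<Rightarrow> ennreal"
  assumes [measurable]: "f \<in> borel_measurable borel" and c: "0 < c"
  shows "(\<integral>\<^sup>+x. f x \<partial>lborel) = ennreal (c ^ DIM('a)) * (\<integral>\<^sup>+x. f (c *\<^sub>R x) \<partial>lborel)"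
  using c
  by (subst lborel_affine[of c 0])
     (simp_all add: nn_integral_density nn_integral_distr nn_integral_cmult)

definition shell :: "'a::real_normed_vector set" where
  "shell = {y. 1 \<le> norm y \<and> norm y < 2}"

lemma shell_measurable [measurable]: "(shell :: 'a::euclidean_space set) \<in> sets borel"
  unfolding shell_def by measurable

text \<open>For |x| = c > 0, the t > 0 with x/t in the shell fill exactly (c/2, c]. Their
  logarithmic length is the constant ln 2 of the polar formula.\<close>

lemma nn_integral_inverse:
  assumes "0 < (c::real)"
  shows "(\<integral>\<^sup>+t. ennreal (1 / t) * indicator {c / 2<..c} t \<partial>lborel) = ennreal (ln 2)"
proof -
  have "(\<integral>\<^sup>+t. ennreal (1 / t) * indicator {c / 2<..c} t \<partial>lborel)
      = (\<integral>\<^sup>+t. ennreal (1 / t) * indicator {c / 2..c} t \<partial>lborel)"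
    by (rule nn_integral_cong_AE)
      (use AE_lborel_singleton[of "c/2"] in \<open>auto split: split_indicator elim!: eventually_mono\<close>)
  also have "\<dots> = ln c - ln (c / 2)"
    by (rule nn_integral_FTC_Icc) (use assms in \<open>auto intro!: derivative_eq_intros simp: field_simps\<close>)
  also have "ln c - ln (c / 2) = ln 2" using assms by (simp add: ln_div)
  finally show ?thesis .
qed

text \<open>Polar coordinates with the unit sphere thickened to the shell \<open>1 \<le> norm y < 2\<close>, so that
  scaling and Tonelli suffice and no surface measure is needed.\<close>

lemma nn_integral_polar:
  fixes G :: "'a::euclidean_space \<Rightarrow> ennreal"
  assumes G [measurable]: "G \<in> borel_measurable borel"
  shows "ennreal (ln 2) * (\<integral>\<^sup>+x. G x \<partial>lborel) =
    (\<integral>\<^sup>+y\<in>shell. ennreal (1 / norm y ^ DIM('a)) *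
      (\<integral>\<^sup>+r\<in>{0<..}. ennreal (r ^ (DIM('a) - 1)) * G (r *\<^sub>R (y /\<^sub>R norm y)) \<partial>lborel) \<partial>lborel)"
proof -
  let ?n = "DIM('a)"
  have n: "t ^ ?n = t * t ^ (?n - 1)" for t :: real
    using DIM_positive[where 'a='a] by (metis Suc_diff_1 power_Suc)
  \<comment> \<open>Substituting r = |y| t removes the normalization of \<open>y\<close>: r^(n-1) dr
    becomes |y|^n t^(n-1) dt, and the weight 1/|y|^n cancels the factor.\<close>
  have inner: "ennreal (1 / norm y ^ ?n) *
      (\<integral>\<^sup>+r\<in>{0<..}. ennreal (r ^ (?n - 1)) * G (r *\<^sub>R (y /\<^sub>R norm y)) \<partial>lborel) =
      (\<integral>\<^sup>+t\<in>{0<..}. ennreal (t ^ (?n - 1)) * G (t *\<^sub>R y) \<partial>lborel)" if y: "y \<in> shell" for y :: 'a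
  proof -
    have y0: "0 < norm y" using y by (auto simp: shell_def)
    have "(\<integral>\<^sup>+r\<in>{0<..}. ennreal (r ^ (?n - 1)) * G (r *\<^sub>R (y /\<^sub>R norm y)) \<partial>lborel)
      = ennreal \<bar>norm y\<bar> * (\<integral>\<^sup>+t. ennreal ((0 + norm y * t) ^ (?n - 1)) * G ((0 + norm y * t) *\<^sub>R (y /\<^sub>R norm y))
          * indicator {0<..} (0 + norm y * t) \<partial>lborel)"
      by (rule nn_integral_real_affine) (use y0 in auto)
    also have "\<dots> = ennreal (norm y) * (\<integral>\<^sup>+t. ennreal (norm y ^ (?n - 1)) *
       (ennreal (t ^ (?n - 1)) * G (t *\<^sub>R y) * indicator {0<..} t) \<partial>lborel)"
    proof -
      have "ennreal ((0 + norm y * t) ^ (?n - 1)) * G ((0 + norm y * t) *\<^sub>R (y /\<^sub>R norm y)) * indicator {0<..} (0 + norm y * t)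
        = ennreal (norm y ^ (?n - 1)) * (ennreal (t ^ (?n - 1)) * G (t *\<^sub>R y) * indicator {0<..} t)" for t
      proof -
        have v: "(0 + norm y * t) *\<^sub>R (y /\<^sub>R norm y) = t *\<^sub>R y"
          using y0 by (simp add: mult.commute[of "norm y"] mult.assoc)
        have i: "indicator {0<..} (0 + norm y * t) = (indicator {0<..} t :: ennreal)"
          using y0 by (simp add: indicator_def zero_less_mult_iff)
        show ?thesis
        proof (cases "0 < t")
          case True
          have "ennreal ((0 + norm y * t) ^ (?n - 1)) = ennreal (norm y ^ (?n - 1)) * ennreal (t ^ (?n - 1))"
            using True by (simp add: power_mult_distrib ennreal_mult)
          then show ?thesis by (simp only: v i mult.assoc)
        qed (simp only: i, simp)
      qed
      then show ?thesis using y0 by simp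
    qed
    also have "\<dots> = ennreal (norm y ^ ?n) * (\<integral>\<^sup>+t\<in>{0<..}. ennreal (t ^ (?n - 1)) * G (t *\<^sub>R y) \<partial>lborel)"
      by (subst nn_integral_cmult) (auto simp: n[of "norm y"] ennreal_mult mult.assoc)
    finally have "ennreal (1 / norm y ^ ?n) *
      (\<integral>\<^sup>+r\<in>{0<..}. ennreal (r ^ (?n - 1)) * G (r *\<^sub>R (y /\<^sub>R norm y)) \<partial>lborel) =
      (ennreal (1 / norm y ^ ?n) * ennreal (norm y ^ ?n)) * (\<integral>\<^sup>+t\<in>{0<..}. ennreal (t ^ (?n - 1)) * G (t *\<^sub>R y) \<partial>lborel)"
      by (simp add: mult.assoc)
    also have "ennreal (1 / norm y ^ ?n) * ennreal (norm y ^ ?n) = 1"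
      using y0 by (subst ennreal_mult[symmetric]) auto
    finally show ?thesis by simp
  qed
  have "(\<integral>\<^sup>+y\<in>shell. ennreal (1 / norm y ^ ?n) *
      (\<integral>\<^sup>+r\<in>{0<..}. ennreal (r ^ (?n - 1)) * G (r *\<^sub>R (y /\<^sub>R norm y)) \<partial>lborel) \<partial>lborel)
    = (\<integral>\<^sup>+y\<in>shell. (\<integral>\<^sup>+t\<in>{0<..}. ennreal (t ^ (?n - 1)) * G (t *\<^sub>R y) \<partial>lborel) \<partial>lborel)"
    by (rule nn_integral_cong) (use inner in \<open>auto split: split_indicator\<close>)
  also have "\<dots> = (\<integral>\<^sup>+y. (\<integral>\<^sup>+t. indicator shell y * (ennreal (t ^ (?n - 1)) * G (t *\<^sub>R y) * indicator {0<..} t) \<partial>lborel) \<partial>lborel)"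
    by (subst nn_integral_cmult) (auto simp: mult.commute)
  also have "\<dots> = (\<integral>\<^sup>+t. (\<integral>\<^sup>+y. indicator shell y * (ennreal (t ^ (?n - 1)) * G (t *\<^sub>R y) * indicator {0<..} t) \<partial>lborel) \<partial>lborel)"
    by (rule lborel_pair.Fubini') measurable
  \<comment> \<open>For fixed t > 0, scaling x = t y turns t^(n-1) dy into dx/t. After a second
    exchange of integrals only the logarithmic integral over t remains.\<close>
  also have "\<dots> = (\<integral>\<^sup>+t. (\<integral>\<^sup>+x. ennreal (1 / t) * indicator {0<..} t * indicator shell (x /\<^sub>R t) * G x \<partial>lborel) \<partial>lborel)"
  proof (rule nn_integral_cong)
    fix t :: real
    show "(\<integral>\<^sup>+y. indicator shell y * (ennreal (t ^ (?n - 1)) * G (t *\<^sub>R y) * indicator {0<..} t) \<partial>lborel) =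
      (\<integral>\<^sup>+x. ennreal (1 / t) * indicator {0<..} t * indicator shell (x /\<^sub>R t) * G x \<partial>lborel)"
    proof (cases "0 < t")
      case True
      have "(\<integral>\<^sup>+x. ennreal (1 / t) * indicator {0<..} t * indicator shell (x /\<^sub>R t) * G x \<partial>lborel) =
        ennreal (t ^ ?n) * (\<integral>\<^sup>+y. ennreal (1 / t) * indicator {0<..} t * indicator shell ((t *\<^sub>R y) /\<^sub>R t) * G (t *\<^sub>R y) \<partial>lborel)"
        by (rule nn_integral_scaleR[OF _ True]) measurable
      also have "\<dots> = (\<integral>\<^sup>+y. ennreal (t ^ ?n) * (ennreal (1 / t) * indicator {0<..} t * indicator shell y * G (t *\<^sub>R y)) \<partial>lborel)"
        using True by (subst nn_integral_cmult) auto
      also have "\<dots> = (\<integral>\<^sup>+y. indicator shell y * (ennreal (t ^ (?n - 1)) * G (t *\<^sub>R y) * indicator {0<..} t) \<partial>lborel)"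
      proof (rule nn_integral_cong)
        fix y :: 'a
        have "ennreal (t ^ ?n) * ennreal (1 / t) = ennreal (t ^ (?n - 1))"
          using True by (subst ennreal_mult[symmetric]) (auto simp: n[of t])
        then have "ennreal (t ^ ?n) * (ennreal (1 / t) * indicator {0<..} t * indicator shell y * G (t *\<^sub>R y)) =
          ennreal (t ^ (?n - 1)) * indicator {0<..} t * indicator shell y * G (t *\<^sub>R y)"
          by (simp only: mult.assoc[symmetric])
        then show "ennreal (t ^ ?n) * (ennreal (1 / t) * indicator {0<..} t * indicator shell y * G (t *\<^sub>R y)) =
          indicator shell y * (ennreal (t ^ (?n - 1)) * G (t *\<^sub>R y) * indicator {0<..} t)"
          by (simp only: mult_ac)
      qed
      finally show ?thesis ..
    qed simp
  qed
  also have "\<dots> = (\<integral>\<^sup>+x. (\<integral>\<^sup>+t. ennreal (1 / t) * indicator {0<..} t * indicator shell (x /\<^sub>R t) * G x \<partial>lborel) \<partial>lborel)"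
    by (rule lborel_pair.Fubini') measurable
  also have "\<dots> = (\<integral>\<^sup>+x. ennreal (ln 2) * G x \<partial>lborel)"
  proof (rule nn_integral_cong_AE)
    show "AE x in lborel. (\<integral>\<^sup>+t. ennreal (1 / t) * indicator {0<..} t * indicator shell (x /\<^sub>R t) * G x \<partial>lborel)
       = ennreal (ln 2) * G x"
      using AE_lborel_singleton[of "0::'a"]
    proof (rule eventually_mono)
      fix x :: 'a assume x: "x \<noteq> 0"
      have "(\<integral>\<^sup>+t. ennreal (1 / t) * indicator {0<..} t * indicator shell (x /\<^sub>R t) * G x \<partial>lborel)
        = (\<integral>\<^sup>+t. ennreal (1 / t) * indicator {norm x / 2<..norm x} t * G x \<partial>lborel)"
      proof (rule nn_integral_cong)
        fix t :: real
        have "indicator {0<..} t * indicator shell (x /\<^sub>R t) = (indicator {norm x / 2<..norm x} t :: ennreal)"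
        proof (cases "0 < t")
          case True
          then have "x /\<^sub>R t \<in> shell \<longleftrightarrow> t \<in> {norm x / 2<..norm x}"
            by (auto simp: shell_def field_simps)
          then show ?thesis using True by (auto simp: indicator_def)
        next
          case False
          then have "t \<notin> {norm x / 2<..norm x}" using norm_ge_zero[of x] by auto
          then show ?thesis using False by simp
        qed
        then show "ennreal (1 / t) * indicator {0<..} t * indicator shell (x /\<^sub>R t) * G x =
          ennreal (1 / t) * indicator {norm x / 2<..norm x} t * G x" by (simp add: mult.assoc)
      qed
      also have "\<dots> = (\<integral>\<^sup>+t. ennreal (1 / t) * indicator {norm x / 2<..norm x} t \<partial>lborel) * G x"
        by (rule nn_integral_multc) measurable
      finally show "(\<integral>\<^sup>+t. ennreal (1 / t) * indicator {0<..} t * indicator shell (x /\<^sub>R t) * G x \<partial>lborel)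
       = ennreal (ln 2) * G x"
        using nn_integral_inverse[of "norm x"] x by simp
    qed
  qed
  also have "\<dots> = ennreal (ln 2) * (\<integral>\<^sup>+x. G x \<partial>lborel)"
    by (rule nn_integral_cmult) measurable
  finally show ?thesis ..
qed

text \<open>The constant is the surface area of the unit sphere, obtained as the weighted mass of
  the shell divided by ln 2. It is finite because the weight is at most 1 on a bounded set, and
  positive because otherwise the whole space would be null.\<close>

lemma nn_integral_radial:
  obtains c where "0 < c" "c < \<infinity>"
    "\<And>g. g \<in> borel_measurable borel \<Longrightarrow> nn_integral lborel (\<lambda>x::'a::euclidean_space. g (norm x)) =
      c * (\<integral>\<^sup>+r\<in>{0<..}. ennreal (r ^ (DIM('a) - 1)) * g r \<partial>lborel)"
proof -
  let ?n = "DIM('a)"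
  define k where "k = (\<integral>\<^sup>+y\<in>(shell :: 'a set). ennreal (1 / norm y ^ ?n) \<partial>lborel)"
  have g: "ennreal (ln 2) * nn_integral lborel (\<lambda>x::'a. g (norm x)) = k * (\<integral>\<^sup>+r\<in>{0<..}. ennreal (r ^ (?n - 1)) * g r \<partial>lborel)"
    if [measurable]: "g \<in> borel_measurable borel" for g
  proof -
    have "ennreal (ln 2) * nn_integral lborel (\<lambda>x::'a. g (norm x)) =
      (\<integral>\<^sup>+y\<in>(shell::'a set). ennreal (1 / norm y ^ ?n) *
      (\<integral>\<^sup>+r\<in>{0<..}. ennreal (r ^ (?n - 1)) * g (norm (r *\<^sub>R (y /\<^sub>R norm y))) \<partial>lborel) \<partial>lborel)"
      by (rule nn_integral_polar) measurable
    also have "\<dots> = (\<integral>\<^sup>+y. (ennreal (1 / norm y ^ ?n) * indicator (shell::'a set) y) *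
      (\<integral>\<^sup>+r\<in>{0<..}. ennreal (r ^ (?n - 1)) * g r \<partial>lborel) \<partial>lborel)"
    proof (rule nn_integral_cong)
      fix y :: 'a
      show "ennreal (1 / norm y ^ ?n) *
        (\<integral>\<^sup>+r\<in>{0<..}. ennreal (r ^ (?n - 1)) * g (norm (r *\<^sub>R (y /\<^sub>R norm y))) \<partial>lborel) * indicator shell y =
        (ennreal (1 / norm y ^ ?n) * indicator (shell::'a set) y) * (\<integral>\<^sup>+r\<in>{0<..}. ennreal (r ^ (?n - 1)) * g r \<partial>lborel)"
      proof (cases "y \<in> shell")
        case True
        then have "y \<noteq> 0" by (auto simp: shell_def)
        then have "(\<integral>\<^sup>+r\<in>{0<..}. ennreal (r ^ (?n - 1)) * g (norm (r *\<^sub>R (y /\<^sub>R norm y))) \<partial>lborel)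
          = (\<integral>\<^sup>+r\<in>{0<..}. ennreal (r ^ (?n - 1)) * g r \<partial>lborel)"
          by (intro nn_integral_cong) (auto simp: mult.assoc split: split_indicator)
        then show ?thesis by (simp add: mult_ac)
      qed simp
    qed
    also have "\<dots> = k * (\<integral>\<^sup>+r\<in>{0<..}. ennreal (r ^ (?n - 1)) * g r \<partial>lborel)"
      unfolding k_def by (rule nn_integral_multc) measurable
    finally show ?thesis .
  qed
  have meas: "emeasure lborel (shell :: 'a set) < \<infinity>"
    by (rule emeasure_bounded_finite) (auto simp: shell_def bounded_iff intro!: exI[of _ 2])
  have "k \<le> (\<integral>\<^sup>+y. 1 * indicator (shell::'a set) y \<partial>lborel)"
    unfolding k_def
    by (intro nn_integral_mono)
      (auto simp: shell_def divide_le_eq one_le_power split: split_indicator intro!: ennreal_le_1[THEN iffD2])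
  also have "\<dots> = emeasure lborel (shell :: 'a set)" by simp
  finally have k_fin: "k < \<infinity>" using meas by (rule le_less_trans)
  have k_pos: "k \<noteq> 0"
  proof
    assume k0: "k = 0"
    have "ennreal (ln 2) * nn_integral lborel (\<lambda>_::'a. 1) = 0" using g[of "\<lambda>_. 1"] k0 by simp
    then show False by simp
  qed
  have ln2: "ennreal (1 / ln 2) * ennreal (ln 2) = 1"
    by (subst ennreal_mult[symmetric]) auto
  show ?thesis
  proof (rule that[of "ennreal (1 / ln 2) * k"])
    show "0 < ennreal (1 / ln 2) * k"
      using k_pos by (simp add: ennreal_zero_less_mult_iff zero_less_iff_neq_zero)
    show "ennreal (1 / ln 2) * k < \<infinity>"
      using k_fin by (simp add: ennreal_mult_less_top)
    fix g :: "real \<Rightarrow> ennreal" assume gm: "g \<in> borel_measurable borel"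
    have "nn_integral lborel (\<lambda>x::'a. g (norm x)) =
      (ennreal (1 / ln 2) * ennreal (ln 2)) * nn_integral lborel (\<lambda>x::'a. g (norm x))"
      by (simp add: ln2)
    also have "\<dots> = ennreal (1 / ln 2) * k * (\<integral>\<^sup>+r\<in>{0<..}. ennreal (r ^ (DIM('a) - 1)) * g r \<partial>lborel)"
      using g[OF gm] by (simp add: mult.assoc)
    finally show "nn_integral lborel (\<lambda>x::'a. g (norm x)) =
      ennreal (1 / ln 2) * k * (\<integral>\<^sup>+r\<in>{0<..}. ennreal (r ^ (DIM('a) - 1)) * g r \<partial>lborel)" .
  qed
qed

subsection \<open>Radial weights\<close>

text \<open>\<open>Ck_on\<close> controls directional derivatives only; the expansion in the basis
  transfers their continuity to the gradient.\<close>

lemma frechet_derivative_gradient: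
  fixes u :: "'a::euclidean_space \<Rightarrow> real"
  assumes "u differentiable (at x)"
  shows "frechet_derivative u (at x) h = h \<bullet> gradient u x"
    and "gradient u x = (\<Sum>b\<in>Basis. frechet_derivative u (at x) b *\<^sub>R b)"
proof -
  let ?D = "\<Sum>b\<in>Basis. frechet_derivative u (at x) b *\<^sub>R b"
  have d: "(u has_derivative frechet_derivative u (at x)) (at x)"
    using assms by (simp add: frechet_derivative_works)
  interpret linear "frechet_derivative u (at x)" using d by (rule has_derivative_linear)
  have eq: "frechet_derivative u (at x) h = h \<bullet> ?D" for h
  proof -
    have "frechet_derivative u (at x) h = frechet_derivative u (at x) (\<Sum>b\<in>Basis. (h \<bullet> b) *\<^sub>R b)"
      by (simp add: euclidean_representation)
    also have "\<dots> = (\<Sum>b\<in>Basis. (h \<bullet> b) * frechet_derivative u (at x) b)"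
      by (simp add: sum scale)
    also have "\<dots> = h \<bullet> ?D" by (simp add: inner_sum_right mult.commute)
    finally show ?thesis .
  qed
  have "(u has_derivative (\<lambda>h. h \<bullet> ?D)) (at x)"
    by (rule has_derivative_eq_rhs[OF d]) (rule ext, rule eq)
  then show g: "gradient u x = ?D" by (rule gradient_eqI)
  show "frechet_derivative u (at x) h = h \<bullet> gradient u x" unfolding g by (rule eq)
qed

lemma ray_derivative:
  fixes u :: "'a::euclidean_space \<Rightarrow> real"
  assumes "u differentiable (at (r *\<^sub>R e))"
  shows "((\<lambda>r. u (r *\<^sub>R e)) has_real_derivative frechet_derivative u (at (r *\<^sub>R e)) e) (at r)"
proof -
  have d: "(u has_derivative frechet_derivative u (at (r *\<^sub>R e))) (at (r *\<^sub>R e))"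
    using assms by (simp add: frechet_derivative_works)
  have "((\<lambda>r. r *\<^sub>R e) has_derivative (\<lambda>h. h *\<^sub>R e)) (at r)"
    by (auto intro!: derivative_eq_intros)
  from has_derivative_compose[OF this d]
  have "((\<lambda>r. u (r *\<^sub>R e)) has_derivative (\<lambda>h. frechet_derivative u (at (r *\<^sub>R e)) (h *\<^sub>R e))) (at r)" .
  moreover have "frechet_derivative u (at (r *\<^sub>R e)) (h *\<^sub>R e) = frechet_derivative u (at (r *\<^sub>R e)) e * h" for h
    using has_derivative_linear[OF d] by (simp add: linear_scale mult.commute)
  ultimately show ?thesis by (simp add: has_field_derivative_def)
qed

lemma open_ball0: "open (ball0 R :: 'a::real_normed_vector set)"
  unfolding ball0_def by (intro open_Collect_less continuous_intros)

lemma mem_ball0_ray: "norm e = 1 \<Longrightarrow> r \<in> einterval 0 R \<Longrightarrow> r *\<^sub>R e \<in> ball0 R - {0}"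
  by (auto simp: ball0_def einterval_iff)

text \<open>On (0,R) the profile is the restriction of \<open>V\<close> to the ray through a basis
  vector, so its derivative is a directional derivative of \<open>V\<close>, which is
  continuous.\<close>

lemma positive_radial_C1_profile:
  fixes V :: "'a::euclidean_space \<Rightarrow> real"
  assumes V: "positive_radial_C1 R V v"
  shows "r \<in> einterval 0 R \<Longrightarrow> 0 < v r"
    and "r \<in> einterval 0 R \<Longrightarrow> (v has_real_derivative deriv v r) (at r)"
    and "continuous_on (einterval 0 R) (deriv v)"
proof -
  obtain e :: 'a where e: "e \<in> Basis" using nonempty_Basis by blast
  then have ne: "norm e = 1" by simp
  have vV: "v r = V (r *\<^sub>R e)" if "r \<in> einterval 0 R" for r
    using V mem_ball0_ray[OF ne that] that by (simp add: positive_radial_C1_def ne einterval_iff)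
  show "0 < v r" if r: "r \<in> einterval 0 R" for r
    using V mem_ball0_ray[OF ne r] unfolding vV[OF r] positive_radial_C1_def by blast
  have D: "(v has_real_derivative frechet_derivative V (at (r *\<^sub>R e)) e) (at r)" if r: "r \<in> einterval 0 R" for r
  proof (rule has_field_derivative_transform_within_open[OF ray_derivative open_einterval r])
    show "V differentiable at (r *\<^sub>R e)"
      using V mem_ball0_ray[OF ne r] by (auto simp: positive_radial_C1_def)
  qed (simp add: vV)
  have dv: "deriv v r = frechet_derivative V (at (r *\<^sub>R e)) e" if "r \<in> einterval 0 R" for r
    using D[OF that] by (rule DERIV_imp_deriv)
  show "(v has_real_derivative deriv v r) (at r)" if "r \<in> einterval 0 R" for r
    using D[OF that] dv[OF that] by simp
  have "continuous_on (ball0 R - {0}) (\<lambda>x. frechet_derivative V (at x) e)"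
    using V by (simp add: positive_radial_C1_def)
  then have "continuous_on (einterval 0 R) (\<lambda>r. frechet_derivative V (at (r *\<^sub>R e)) e)"
    by (rule continuous_on_compose2) (use mem_ball0_ray[OF ne] in \<open>auto intro!: continuous_intros\<close>)
  then show "continuous_on (einterval 0 R) (deriv v)"
    by (rule continuous_on_eq) (simp add: dv)
qed

locale radial_weights =
  fixes R :: ereal and V W :: "'a::euclidean_space \<Rightarrow> real" and v w :: "real \<Rightarrow> real"
  assumes R_pos: "0 < R" and V: "positive_radial_C1 R V v" and W: "positive_radial_C1 R W w"
begin

definition P :: "real \<Rightarrow> real" where "P r = r ^ (DIM('a) - 1) * v r"
definition Q :: "real \<Rightarrow> real" where "Q r = r ^ (DIM('a) - 1) * w r"
text \<open>In dimension 1 the truncated exponent is harmless, because its coefficient is 0.\<close>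

definition P' :: "real \<Rightarrow> real" where
  "P' r = real (DIM('a) - 1) * r ^ (DIM('a) - 1 - 1) * v r + r ^ (DIM('a) - 1) * deriv v r"

lemmas v_props = positive_radial_C1_profile[OF V]
lemmas w_props = positive_radial_C1_profile[OF W]

lemma v_cont: "continuous_on (einterval 0 R) v"
  by (rule DERIV_continuous_on, rule has_field_derivative_at_within, rule v_props(2))

lemma w_cont: "continuous_on (einterval 0 R) w"
  by (rule DERIV_continuous_on, rule has_field_derivative_at_within, rule w_props(2))

sublocale sturm_liouville 0 R P P' Q
proof
  fix r assume r: "r \<in> einterval 0 R"
  then have "0 < r" by (simp add: einterval_iff)
  then show "0 < P r" "0 < Q r" using v_props(1)[OF r] w_props(1)[OF r] by (simp_all add: P_def Q_def)
  show "(P has_real_derivative P' r) (at r)"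
    unfolding P_def[abs_def] P'_def
    using DERIV_mult[OF DERIV_pow v_props(2)[OF r], of "DIM('a) - 1"]
    by (simp add: algebra_simps)
next
  show "continuous_on (einterval 0 R) P'"
    unfolding P'_def[abs_def] by (intro continuous_intros v_cont v_props(3))
  show "continuous_on (einterval 0 R) Q"
    unfolding Q_def[abs_def] by (intro continuous_intros w_cont)
qed

text \<open>\<open>P\<close> is the integrating factor of the equation: the coefficient of y' is
  P'/P, so multiplying by \<open>P\<close> brings the equation to the form (P y')' + Q y =
  0.\<close>

lemma P'_eq:
  assumes r: "r \<in> einterval 0 R"
  shows "P' r = P r * ((real DIM('a) - 1) / r + deriv v r / v r)"
proof -
  have r0: "0 < r" and v0: "0 < v r" using r v_props(1) by (auto simp: einterval_iff)
  have n: "real (DIM('a) - 1) = real DIM('a) - 1" using DIM_positive[where 'a='a] by (simp add: of_nat_diff Suc_leI)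
  have "real (DIM('a) - 1) * r ^ (DIM('a) - 1 - 1) = r ^ (DIM('a) - 1) * (real (DIM('a) - 1) / r)"
    using r0 by (cases "DIM('a) - 1") auto
  then show ?thesis using v0 unfolding P'_def P_def n[symmetric] by (simp add: algebra_simps)
qed

section \<open>The radial equation and the Sturm--Liouville system\<close>

lemma solution_of_positive_solution:
  assumes "positive_solution DIM('a) R v w \<phi>"
  obtains z where "solution \<phi> z" "\<And>r. r \<in> einterval 0 R \<Longrightarrow> 0 < \<phi> r"
proof -
  obtain \<phi>' \<phi>'' where D: "\<And>r. r \<in> einterval 0 R \<Longrightarrow> (\<phi> has_real_derivative \<phi>' r) (at r)"
    "\<And>r. r \<in> einterval 0 R \<Longrightarrow> (\<phi>' has_real_derivative \<phi>'' r) (at r)"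
    "\<And>r. r \<in> einterval 0 R \<Longrightarrow> \<phi>'' r + ((real DIM('a) - 1) / r + deriv v r / v r) * \<phi>' r + w r / v r * \<phi> r = 0"
    using assms unfolding positive_solution_def by (auto simp: einterval_iff)
  have "solution \<phi> (\<lambda>r. P r * \<phi>' r)"
    unfolding solution_def
  proof (intro ballI conjI)
    fix r assume r: "r \<in> einterval 0 R"
    show "(\<phi> has_real_derivative P r * \<phi>' r / P r) (at r)" using D(1)[OF r] P_pos[OF r] by simp
    have "P' r * \<phi>' r + \<phi>'' r * P r = P r * (\<phi>'' r + ((real DIM('a) - 1) / r + deriv v r / v r) * \<phi>' r)"
      unfolding P'_eq[OF r] by (simp add: algebra_simps)
    also have "\<dots> = P r * (- (w r / v r * \<phi> r))" using D(3)[OF r] by (simp add: add_eq_0_iff)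
    also have "\<dots> = - Q r * \<phi> r" using v_props(1)[OF r] by (simp add: P_def Q_def)
    finally show "((\<lambda>r. P r * \<phi>' r) has_real_derivative - Q r * \<phi> r) (at r)"
      using DERIV_mult[OF P_deriv[OF r] D(2)[OF r]] by simp
  qed
  then show ?thesis
    by (rule that) (use assms in \<open>auto simp: positive_solution_def einterval_iff\<close>)
qed

lemma positive_solution_of_solution:
  assumes sol: "solution y z" and pos: "\<And>r. r \<in> einterval 0 R \<Longrightarrow> 0 < y r"
    and z: "\<And>r. r \<in> einterval 0 R \<Longrightarrow> z r \<le> 0"
  shows "\<exists>\<phi>. positive_solution DIM('a) R v w \<phi>"
proof -
  \<comment> \<open>Since \<open>y\<close> is nonincreasing and positive, its infimum is its limit
    at a finite \<open>R\<close>; this is the endpoint value, and it may be 0.\<close>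
  define \<phi> where "\<phi> r = (if ereal r < R then y r else Inf (y ` einterval 0 R))" for r
  have \<phi>_y: "\<phi> r = y r" if "r \<in> einterval 0 R" for r using that by (simp add: \<phi>_def einterval_iff)
  have d\<phi>: "(\<phi> has_real_derivative z r / P r) (at r)" if r: "r \<in> einterval 0 R" for r
  proof (rule has_field_derivative_transform_within_open[OF _ open_einterval r])
    show "(y has_real_derivative z r / P r) (at r)" using sol r by (simp add: solution_def)
  qed (simp add: \<phi>_y)
  have mono: "y s \<le> y r" if "r \<in> einterval 0 R" "s \<in> einterval 0 R" "r \<le> s" for r s
  proof (rule DERIV_nonpos_imp_nonincreasing[OF that(3)])
    fix x assume "r \<le> x" "x \<le> s"
    then have x: "x \<in> einterval 0 R" using Icc_subset[OF that(1,2)] by auto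
    have "(y has_real_derivative z x / P x) (at x)" using sol x by (simp add: solution_def)
    moreover have "z x / P x \<le> 0" using z[OF x] P_pos[OF x] by (simp add: divide_nonpos_pos)
    ultimately show "\<exists>y'. (y has_real_derivative y') (at x) \<and> y' \<le> 0" by blast
  qed
  have cont: "continuous_on {r. 0 < r \<and> ereal r \<le> R} \<phi>"
    unfolding continuous_on_eq_continuous_within
  proof
    fix x assume "x \<in> {r. 0 < r \<and> ereal r \<le> R}"
    then consider "x \<in> einterval 0 R" | "0 < x" "R = ereal x" by (auto simp: einterval_iff le_less)
    then show "continuous (at x within {r. 0 < r \<and> ereal r \<le> R}) \<phi>"
    proof cases
      case 1
      then show ?thesis using d\<phi> DERIV_isCont continuous_at_imp_continuous_at_within by blast
    next
      case 2
      have I: "einterval 0 R = {0<..<x}" using 2 by (auto simp: einterval_iff)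
      define L where "L = Inf (y ` {0<..<x})"
      have \<phi>x: "\<phi> x = L" using 2 I by (simp add: \<phi>_def L_def)
      have ne: "y ` {0<..<x} \<noteq> {}" using 2 by simp
      have bdd: "bdd_below (y ` {0<..<x})" using pos I by (intro bdd_belowI2[of _ 0]) (auto intro: less_imp_le)
      show ?thesis
        unfolding continuous_within_eps_delta
      proof (intro allI impI)
        fix e :: real assume "0 < e"
        then have "Inf (y ` {0<..<x}) < L + e" by (simp add: L_def)
        then obtain s where s: "s \<in> {0<..<x}" "y s < L + e" using cInf_less_iff[OF ne bdd] by blast
        show "\<exists>d>0. \<forall>x'\<in>{r. 0 < r \<and> ereal r \<le> R}. dist x' x < d \<longrightarrow> dist (\<phi> x') (\<phi> x) < e"
        proof (intro exI[of _ "x - s"] conjI ballI impI)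
          show "0 < x - s" using s by simp
          fix t assume t: "t \<in> {r. 0 < r \<and> ereal r \<le> R}" "dist t x < x - s"
          show "dist (\<phi> t) (\<phi> x) < e"
          proof (cases "t = x")
            case False
            then have tI: "t \<in> {0<..<x}" "s \<le> t" using t 2 by (auto simp: dist_real_def)
            have "L \<le> y t" unfolding L_def by (rule cInf_lower[OF _ bdd]) (use tI in simp)
            moreover have "y t \<le> y s" by (rule mono) (use s tI I in auto)
            ultimately show ?thesis using s \<phi>_y[of t] tI I by (simp add: dist_real_def \<phi>x)
          qed (use \<open>0 < e\<close> in simp)
        qed
      qed
    qed
  qed
  have d2: "((\<lambda>r. z r / P r) has_real_derivative (- Q r * y r * P r - z r * P' r) / (P r * P r)) (at r)"
    if r: "r \<in> einterval 0 R" for r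
  proof (rule DERIV_divide[OF _ P_deriv[OF r]])
    show "(z has_real_derivative - Q r * y r) (at r)" using sol r by (simp add: solution_def)
    show "P r \<noteq> 0" using P_pos[OF r] by simp
  qed
  have ode: "(- Q r * y r * P r - z r * P' r) / (P r * P r) + ((real DIM('a) - 1) / r + deriv v r / v r) * (z r / P r) + w r / v r * \<phi> r = 0"
    if r: "r \<in> einterval 0 R" for r
  proof -
    have p: "0 < P r" by (rule P_pos[OF r])
    define c where "c = (real DIM('a) - 1) / r + deriv v r / v r"
    have "0 < r" using r by (simp add: einterval_iff)
    then have q: "Q r = P r * (w r / v r)" using v_props(1)[OF r] by (simp add: P_def Q_def)
    show ?thesis unfolding P'_eq[OF r] c_def[symmetric] q \<phi>_y[OF r] using p by (simp add: field_simps)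
  qed
  have "positive_solution DIM('a) R v w \<phi>"
    unfolding positive_solution_def
  proof (intro conjI cont allI impI exI)
    fix r :: real assume "0 < r \<and> ereal r < R"
    then have r: "r \<in> einterval 0 R" by (simp add: einterval_iff)
    show "0 < \<phi> r" using pos[OF r] \<phi>_y[OF r] by simp
    show "(\<phi> has_real_derivative z r / P r) (at r)" by (rule d\<phi>[OF r])
    show "((\<lambda>r. z r / P r) has_real_derivative (- Q r * y r * P r - z r * P' r) / (P r * P r)) (at r)" by (rule d2[OF r])
    show "(- Q r * y r * P r - z r * P' r) / (P r * P r) + ((real DIM('a) - 1) / r + deriv v r / v r) * (z r / P r) + w r / v r * \<phi> r = 0"
      by (rule ode[OF r])
  qed
  then show ?thesis by blast
qed

section \<open>The inequality on the ball and the one-dimensional form\<close>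

lemma punctured_ball_integral:
  fixes g :: "'a \<Rightarrow> real"
  shows "(\<integral>\<^sup>+x\<in>ball0 R. ennreal (g x) \<partial>lborel) = (\<integral>\<^sup>+x\<in>ball0 R - {0}. ennreal (g x) \<partial>lborel)"
  by (rule nn_integral_cong_AE)
    (use AE_lborel_singleton[of "0::'a"] in \<open>auto elim!: eventually_mono split: split_indicator\<close>)

lemma V_cont: "continuous_on (ball0 R - {0}) V" and W_cont: "continuous_on (ball0 R - {0}) W"
  using V W unfolding positive_radial_C1_def
  by (intro continuous_at_imp_continuous_on ballI differentiable_imp_continuous_within; simp)+

lemma V_ray: "x \<in> ball0 R - {0} \<Longrightarrow> V x = v (norm x)" and W_ray: "x \<in> ball0 R - {0} \<Longrightarrow> W x = w (norm x)"
  using V W unfolding positive_radial_C1_def by blast+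

text \<open>Along a ray the derivative of \<open>u\<close> is at most the norm of the gradient, so
  \<open>hardy_ray\<close> bounds each inner integral of the polar formula. The finite positive
  factor ln 2 is cancelled at the end.\<close>

lemma hardy_inequality:
  assumes sol: "solution y z" and pos: "\<And>r. r \<in> einterval 0 R \<Longrightarrow> 0 < y r"
    and z: "\<And>r. r \<in> einterval 0 R \<Longrightarrow> z r \<le> 0"
    and u: "u \<in> test_functions (ball0 R :: 'a set)"
  shows "(\<integral>\<^sup>+x\<in>ball0 R. ennreal (W x * (u x)\<^sup>2) \<partial>lborel) \<le>
    (\<integral>\<^sup>+x\<in>ball0 R. ennreal (V x * (norm (gradient u x))\<^sup>2) \<partial>lborel)"
proof -
  let ?S = "ball0 R - {0} :: 'a set"
  let ?n = "DIM('a)"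
  have S: "?S \<in> sets borel" using open_ball0[of R] by measurable
  have C1: "Ck_on 1 UNIV u" using u by (simp add: test_functions_def del: Ck_on.simps One_nat_def)
  have diff: "u differentiable (at x)" for x using C1 by simp
  have cd: "continuous_on UNIV (\<lambda>x. frechet_derivative u (at x) h)" for h using C1 by simp
  have cu: "continuous_on A u" for A
    by (rule differentiable_imp_continuous_on) (auto simp: differentiable_on_def intro: differentiable_at_withinI diff)
  have cg: "continuous_on A (\<lambda>x. norm (gradient u x))" for A
    unfolding frechet_derivative_gradient(2)[OF diff]
    by (intro continuous_intros continuous_on_subset[OF cd]) auto
  define G1 where "G1 x = ennreal (V x * (norm (gradient u x))\<^sup>2) * indicator ?S x" for x
  define G2 where "G2 x = ennreal (W x * (u x)\<^sup>2) * indicator ?S x" for x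
  have G1m: "G1 \<in> borel_measurable borel" unfolding G1_def[abs_def]
    by (intro ennreal_indicator_continuous_measurable[OF S] continuous_intros V_cont cg)
  have G2m: "G2 \<in> borel_measurable borel" unfolding G2_def[abs_def]
    by (intro ennreal_indicator_continuous_measurable[OF S] continuous_intros W_cont cu)
  \<comment> \<open>The norm attains a maximum below \<open>R\<close> on the compact support; any
    radius strictly between works for all rays at once. An empty support is treated apart, since no
    maximum exists there.\<close>
  obtain h where h: "h \<in> einterval 0 R" "\<And>x. u x \<noteq> 0 \<Longrightarrow> norm x < h"
  proof -
    let ?K = "closure {x. u x \<noteq> 0}"
    have K: "compact ?K" "?K \<subseteq> ball0 R" using u by (auto simp: test_functions_def)
    have "\<exists>M\<ge>0. ereal M < R \<and> (\<forall>x\<in>?K. norm x \<le> M)"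
    proof (cases "?K = {}")
      case True then show ?thesis using R_pos by (intro exI[of _ 0]) (auto simp flip: zero_ereal_def)
    next
      case False
      then obtain x0 where x0: "x0 \<in> ?K" "\<forall>x\<in>?K. norm x \<le> norm x0"
        using continuous_attains_sup[OF K(1) False, of norm] by (auto intro: continuous_intros)
      then show ?thesis using K(2) by (intro exI[of _ "norm x0"]) (auto simp: ball0_def)
    qed
    then obtain M where M: "0 \<le> M" "ereal M < R" "\<And>x. x \<in> ?K \<Longrightarrow> norm x \<le> M" by blast
    obtain h where "ereal M < ereal h" "ereal h < R" using ereal_dense2[OF M(2)] by blast
    then have hI: "h \<in> einterval 0 R" and Mh: "M < h" using M(1) by (auto simp: einterval_iff)
    have "norm x < h" if "u x \<noteq> 0" for x
    proof -
      have "x \<in> ?K" using closure_subset[of "{x. u x \<noteq> 0}"] that by auto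
      then show ?thesis using M(3)[of x] Mh by simp
    qed
    then show ?thesis by (rule that[OF hI])
  qed
  have ray: "(\<integral>\<^sup>+r\<in>{0<..}. ennreal (r ^ (?n - 1)) * G2 (r *\<^sub>R e) \<partial>lborel) \<le>
    (\<integral>\<^sup>+r\<in>{0<..}. ennreal (r ^ (?n - 1)) * G1 (r *\<^sub>R e) \<partial>lborel)" if e: "norm e = 1" for e :: 'a
  proof -
    define f where "f r = u (r *\<^sub>R e)" for r
    define f' where "f' r = frechet_derivative u (at (r *\<^sub>R e)) e" for r
    have df: "(f has_real_derivative f' r) (at r)" for r
      unfolding f_def[abs_def] f'_def by (rule ray_derivative[OF diff])
    have cf': "continuous_on (einterval 0 R) f'"
      unfolding f'_def[abs_def] by (intro continuous_on_compose2[OF cd] continuous_intros) auto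
    have fh: "f r = 0" if "h \<le> r" for r
      using h(2)[of "r *\<^sub>R e"] that e h(1) by (auto simp: f_def einterval_iff)
    have mem: "r *\<^sub>R e \<in> ?S \<longleftrightarrow> r \<in> einterval 0 R" if "0 < r" for r
      using that e by (auto simp: ball0_def einterval_iff)
    have "(\<integral>\<^sup>+r\<in>{0<..}. ennreal (r ^ (?n - 1)) * G2 (r *\<^sub>R e) \<partial>lborel) = (\<integral>\<^sup>+r\<in>einterval 0 R. ennreal (Q r * (f r)\<^sup>2) \<partial>lborel)"
    proof (rule nn_integral_cong)
      fix r :: real
      show "ennreal (r ^ (?n - 1)) * G2 (r *\<^sub>R e) * indicator {0<..} r = ennreal (Q r * (f r)\<^sup>2) * indicator (einterval 0 R) r"
      proof (cases "r \<in> einterval 0 R")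
        case True
        then have r: "0 < r" by (simp add: einterval_iff)
        have "r *\<^sub>R e \<in> ?S" using mem[OF r] True by simp
        moreover have "W (r *\<^sub>R e) = w r" using W_ray[OF calculation] r e by simp
        ultimately show ?thesis using True r
          by (simp add: G2_def Q_def f_def ennreal_mult'[symmetric] mult.assoc)
      next
        case False
        then show ?thesis using mem[of r] by (cases "0 < r") (auto simp: G2_def)
      qed
    qed
    also have "\<dots> \<le> (\<integral>\<^sup>+r\<in>einterval 0 R. ennreal (P r * (f' r)\<^sup>2) \<partial>lborel)"
      by (rule hardy_ray[OF refl sol pos z df cf' h(1) fh])
    also have "\<dots> \<le> (\<integral>\<^sup>+r\<in>{0<..}. ennreal (r ^ (?n - 1)) * G1 (r *\<^sub>R e) \<partial>lborel)"
    proof (rule nn_integral_mono)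
      fix r :: real
      show "ennreal (P r * (f' r)\<^sup>2) * indicator (einterval 0 R) r \<le> ennreal (r ^ (?n - 1)) * G1 (r *\<^sub>R e) * indicator {0<..} r"
      proof (cases "r \<in> einterval 0 R")
        case True
        then have r: "0 < r" by (simp add: einterval_iff)
        have m: "r *\<^sub>R e \<in> ?S" using mem[OF r] True by simp
        have Vr: "V (r *\<^sub>R e) = v r" using V_ray[OF m] r e by simp
        have "\<bar>f' r\<bar> \<le> norm (gradient u (r *\<^sub>R e))"
          unfolding f'_def frechet_derivative_gradient(1)[OF diff]
          using Cauchy_Schwarz_ineq2[of e "gradient u (r *\<^sub>R e)"] e by simp
        then have "(f' r)\<^sup>2 \<le> (norm (gradient u (r *\<^sub>R e)))\<^sup>2" by (metis abs_ge_zero power2_abs power_mono)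
        then have "P r * (f' r)\<^sup>2 \<le> P r * (norm (gradient u (r *\<^sub>R e)))\<^sup>2"
          using P_pos[OF True] by (intro mult_left_mono) auto
        also have "\<dots> = r ^ (?n - 1) * (V (r *\<^sub>R e) * (norm (gradient u (r *\<^sub>R e)))\<^sup>2)" by (simp add: P_def Vr)
        finally have "ennreal (P r * (f' r)\<^sup>2) \<le> ennreal (r ^ (?n - 1) * (V (r *\<^sub>R e) * (norm (gradient u (r *\<^sub>R e)))\<^sup>2))"
          by (rule ennreal_leI)
        also have "\<dots> = ennreal (r ^ (?n - 1)) * G1 (r *\<^sub>R e)"
          using m r by (simp add: G1_def ennreal_mult')
        finally show ?thesis using True r by simp
      qed simp
    qed
    finally show ?thesis .
  qed
  have "ennreal (ln 2) * (\<integral>\<^sup>+x. G2 x \<partial>lborel) \<le> ennreal (ln 2) * (\<integral>\<^sup>+x. G1 x \<partial>lborel)"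
    unfolding nn_integral_polar[OF G1m] nn_integral_polar[OF G2m]
  proof (rule nn_integral_mono)
    fix y :: 'a
    show "ennreal (1 / norm y ^ ?n) * (\<integral>\<^sup>+r\<in>{0<..}. ennreal (r ^ (?n - 1)) * G2 (r *\<^sub>R (y /\<^sub>R norm y)) \<partial>lborel) * indicator shell y
      \<le> ennreal (1 / norm y ^ ?n) * (\<integral>\<^sup>+r\<in>{0<..}. ennreal (r ^ (?n - 1)) * G1 (r *\<^sub>R (y /\<^sub>R norm y)) \<partial>lborel) * indicator shell y"
    proof (cases "y \<in> shell")
      case True
      then have "0 < norm y" by (auto simp: shell_def)
      then have "norm (y /\<^sub>R norm y) = 1" by simp
      then show ?thesis by (intro mult_right_mono mult_left_mono ray) auto
    qed simp
  qed
  then have "(\<integral>\<^sup>+x. G2 x \<partial>lborel) \<le> (\<integral>\<^sup>+x. G1 x \<partial>lborel)"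
    by (subst (asm) ennreal_mult_le_mult_iff) auto
  then show ?thesis by (simp add: punctured_ball_integral G1_def G2_def)
qed

text \<open>The sphere constant is a parameter, so that the two sides of the inequality receive the
  same \<open>c\<close> and it can be cancelled.\<close>

lemma radial_integral:
  fixes F :: "'a \<Rightarrow> real"
  assumes F: "\<And>x. x \<in> ball0 R - {0} \<Longrightarrow> F x = k (norm x)"
    and c: "\<And>g. g \<in> borel_measurable borel \<Longrightarrow> nn_integral lborel (\<lambda>x::'a. g (norm x)) =
      c * (\<integral>\<^sup>+r\<in>{0<..}. ennreal (r ^ (DIM('a) - 1)) * g r \<partial>lborel)"
    and k: "continuous_on (einterval 0 R) k" "\<And>r. r \<in> einterval 0 R \<Longrightarrow> 0 \<le> k r"
    and lh: "l \<in> einterval 0 R" "h \<in> einterval 0 R" "\<And>r. r \<in> einterval 0 R \<Longrightarrow> r \<notin> {l..h} \<Longrightarrow> k r = 0"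
  shows "(\<integral>\<^sup>+x\<in>ball0 R. ennreal (F x) \<partial>lborel) = c * ennreal (integral {l..h} (\<lambda>r. r ^ (DIM('a) - 1) * k r))"
proof -
  have sub: "{l..h} \<subseteq> einterval 0 R" by (rule Icc_subset[OF lh(1,2)])
  have "(\<integral>\<^sup>+x\<in>ball0 R. ennreal (F x) \<partial>lborel) = (\<integral>\<^sup>+x\<in>ball0 R - {0}. ennreal (F x) \<partial>lborel)"
    by (rule punctured_ball_integral)
  also have "\<dots> = nn_integral lborel (\<lambda>x::'a. ennreal (k (norm x)) * indicator (einterval 0 R) (norm x))"
    by (rule nn_integral_cong) (auto simp: F ball0_def einterval_iff split: split_indicator)
  also have "\<dots> = c * (\<integral>\<^sup>+r\<in>{0<..}. ennreal (r ^ (DIM('a) - 1)) * (ennreal (k r) * indicator (einterval 0 R) r) \<partial>lborel)"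
    by (rule c[OF ennreal_indicator_continuous_measurable]) (auto intro: k)
  also have "(\<integral>\<^sup>+r\<in>{0<..}. ennreal (r ^ (DIM('a) - 1)) * (ennreal (k r) * indicator (einterval 0 R) r) \<partial>lborel) =
     (\<integral>\<^sup>+r. ennreal (r ^ (DIM('a) - 1) * k r) * indicator {l..h} r \<partial>lborel)"
  proof (rule nn_integral_cong)
    fix r :: real
    show "ennreal (r ^ (DIM('a) - 1)) * (ennreal (k r) * indicator (einterval 0 R) r) * indicator {0<..} r =
      ennreal (r ^ (DIM('a) - 1) * k r) * indicator {l..h} r"
    proof (cases "r \<in> einterval 0 R")
      case True
      then have r0: "0 < r" by (simp add: einterval_iff)
      then show ?thesis using True lh(3)[OF True] k(2)[OF True]
        by (cases "r \<in> {l..h}") (simp_all add: ennreal_mult)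
    next
      case False
      then show ?thesis using sub by (auto split: split_indicator)
    qed
  qed
  also have "\<dots> = ennreal (integral {l..h} (\<lambda>r. r ^ (DIM('a) - 1) * k r))"
  proof (rule nn_integral_has_integral_lebesgue'[OF _ integrable_integral])
    show "0 \<le> r ^ (DIM('a) - 1) * k r" if "r \<in> {l..h}" for r
      using that sub k(2)[of r] by (auto simp: einterval_iff subset_iff intro!: mult_nonneg_nonneg zero_le_power)
    show "(\<lambda>r. r ^ (DIM('a) - 1) * k r) integrable_on {l..h}"
      by (intro integrable_continuous_interval continuous_intros continuous_on_subset[OF k(1) sub])
  qed
  finally show ?thesis .
qed

text \<open>Applied to a radial test function, the inequality becomes, after cancelling the sphere
  constant, nonnegativity of the form on profiles polynomial times bump;
  \<open>nonneg_form_approximation\<close> extends it to all C^1 profiles.\<close>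

lemma nonneg_form_of_inequality:
  assumes ineq: "\<And>u. u \<in> test_functions (ball0 R :: 'a set) \<Longrightarrow>
    (\<integral>\<^sup>+x\<in>ball0 R. ennreal (W x * (u x)\<^sup>2) \<partial>lborel) \<le>
    (\<integral>\<^sup>+x\<in>ball0 R. ennreal (V x * (norm (gradient u x))\<^sup>2) \<partial>lborel)"
  shows nonneg_form
  unfolding nonneg_form_def
proof (intro allI impI)
  fix f f' :: "real \<Rightarrow> real" and lo l u hi :: real
  assume lo: "lo \<in> einterval 0 R" and hi: "hi \<in> einterval 0 R" and ord: "lo < l" "l < u" "u < hi"
    and f: "\<forall>r. (f has_real_derivative f' r) (at r)" "continuous_on UNIV f'" "\<forall>r. r \<notin> {l..u} \<longrightarrow> f r = 0 \<and> f' r = 0"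
  have sub: "{lo..hi} \<subseteq> einterval 0 R" by (rule Icc_subset[OF lo hi])
  have pos: "0 < lo" "lo < hi" using lo ord by (auto simp: einterval_iff)
  have cP: "continuous_on {lo..hi} P" and cQ: "continuous_on {lo..hi} Q"
    using P_cont Q_cont sub continuous_on_subset by blast+
  obtain c where c: "0 < c" "c < \<infinity>" "\<And>g. g \<in> borel_measurable borel \<Longrightarrow> nn_integral lborel (\<lambda>x::'a. g (norm x)) =
      c * (\<integral>\<^sup>+r\<in>{0<..}. ennreal (r ^ (DIM('a) - 1)) * g r \<partial>lborel)"
    by (rule nn_integral_radial[where 'a='a], rule that; blast)
  show "0 \<le> integral {lo..hi} (\<lambda>r. P r * (f' r)\<^sup>2 - Q r * (f r)\<^sup>2)"
  proof (rule nonneg_form_approximation[OF pos(1) ord cP cQ])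
    show "(f has_real_derivative f' r) (at r)" for r using f by blast
    show "continuous_on UNIV f'" by (rule f)
    show "f r = 0 \<and> f' r = 0" if "r \<notin> {l..u}" for r using f that by blast
    fix p
    let ?b = "\<lambda>r. poly p (r\<^sup>2) * bump (lo\<^sup>2) (hi\<^sup>2) (r\<^sup>2)"
    let ?d = "radial_test_deriv p (lo\<^sup>2) (hi\<^sup>2)"
    have cb: "continuous_on A (\<lambda>r. bump (lo\<^sup>2) (hi\<^sup>2) (r\<^sup>2))" "continuous_on A (\<lambda>r. bump' (lo\<^sup>2) (hi\<^sup>2) (r\<^sup>2))" for A
      by (rule continuous_on_compose2[OF bump_cont(1)[of UNIV]] continuous_on_compose2[OF bump_cont(2)[of UNIV]],
          auto intro!: continuous_intros)+
    have cd: "continuous_on A ?d" for A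
      unfolding radial_test_deriv_def[abs_def] by (intro continuous_intros cb)
    have zero: "bump (lo\<^sup>2) (hi\<^sup>2) (r\<^sup>2) = 0 \<and> bump' (lo\<^sup>2) (hi\<^sup>2) (r\<^sup>2) = 0" if "r \<in> einterval 0 R" "r \<notin> {lo..hi}" for r
    proof (rule bump_eq_0)
      have "0 < r" using that by (simp add: einterval_iff)
      then show "r\<^sup>2 \<le> lo\<^sup>2 \<or> hi\<^sup>2 \<le> r\<^sup>2" using that(2) pos by (auto simp: not_le intro!: power_mono)
    qed
    have mem: "(radial_test p (lo\<^sup>2) (hi\<^sup>2) :: 'a \<Rightarrow> real) \<in> test_functions (ball0 R)"
      by (rule radial_test_mem) (use pos hi in \<open>auto simp: einterval_iff intro!: power_strict_mono\<close>)
    have "(\<integral>\<^sup>+x\<in>ball0 R. ennreal (W x * (radial_test p (lo\<^sup>2) (hi\<^sup>2) x)\<^sup>2) \<partial>lborel)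
      = c * ennreal (integral {lo..hi} (\<lambda>r. r ^ (DIM('a) - 1) * (w r * (?b r)\<^sup>2)))"
      by (rule radial_integral[OF _ c(3) _ _ lo hi])
        (use zero w_props(1) in \<open>auto simp: W_ray radial_test_def dot_square_norm less_imp_le intro!: continuous_intros w_cont cb\<close>)
    moreover have "(\<integral>\<^sup>+x\<in>ball0 R. ennreal (V x * (norm (gradient (radial_test p (lo\<^sup>2) (hi\<^sup>2)) x))\<^sup>2) \<partial>lborel)
      = c * ennreal (integral {lo..hi} (\<lambda>r. r ^ (DIM('a) - 1) * (v r * (?d r)\<^sup>2)))"
      by (rule radial_integral[OF _ c(3) _ _ lo hi])
        (use zero v_props(1) in \<open>auto simp: V_ray norm_gradient_radial_test radial_test_deriv_def[of p "lo\<^sup>2" "hi\<^sup>2"] less_imp_le intro!: continuous_intros v_cont cb\<close>)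
    ultimately have "c * ennreal (integral {lo..hi} (\<lambda>r. Q r * (?b r)\<^sup>2)) \<le> c * ennreal (integral {lo..hi} (\<lambda>r. P r * (?d r)\<^sup>2))"
      using ineq[OF mem] by (simp add: P_def Q_def mult.assoc)
    then have "ennreal (integral {lo..hi} (\<lambda>r. Q r * (?b r)\<^sup>2)) \<le> ennreal (integral {lo..hi} (\<lambda>r. P r * (?d r)\<^sup>2))"
      using c(1,2) by (subst (asm) ennreal_mult_le_mult_iff) auto
    \<comment> \<open>\<open>ennreal\<close> sends negative reals to 0, so an inequality between its
      values yields one between reals only once the right side is known to be nonnegative.\<close>
    moreover have "0 \<le> integral {lo..hi} (\<lambda>r. P r * (?d r)\<^sup>2)"
    proof (rule integral_nonneg)
      show "(\<lambda>r. P r * (?d r)\<^sup>2) integrable_on {lo..hi}"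
        by (intro integrable_continuous_interval continuous_intros cP cd)
      show "0 \<le> P r * (?d r)\<^sup>2" if "r \<in> {lo..hi}" for r
      proof -
        have "r \<in> einterval 0 R" using sub that by auto
        from P_pos[OF this] show ?thesis by simp
      qed
    qed
    ultimately have "integral {lo..hi} (\<lambda>r. Q r * (?b r)\<^sup>2) \<le> integral {lo..hi} (\<lambda>r. P r * (?d r)\<^sup>2)"
      by (simp add: ennreal_le_iff)
    moreover have "integral {lo..hi} (\<lambda>r. P r * (?d r)\<^sup>2 - Q r * (?b r)\<^sup>2) =
      integral {lo..hi} (\<lambda>r. P r * (?d r)\<^sup>2) - integral {lo..hi} (\<lambda>r. Q r * (?b r)\<^sup>2)"
      by (intro integral_diff integrable_continuous_interval continuous_intros cP cQ cd cb)
    ultimately show "0 \<le> integral {lo..hi} (\<lambda>r. P r * (?d r)\<^sup>2 - Q r * (?b r)\<^sup>2)" by simp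
  qed
qed

end

theorem theorem2p1:
  fixes R :: ereal
    and V W :: "'a::euclidean_space \<Rightarrow> real"
    and v w :: "real \<Rightarrow> real"
  assumes "0 < R"
    and "positive_radial_C1 R V v"
    and "positive_radial_C1 R W w"
    and "\<exists>a. 0 < a \<and> ereal a < R \<and>
          (\<integral>\<^sup>+ r\<in>{0<..<a}. ennreal (1 / (r ^ (DIM('a) - 1) * v r)) \<partial>lborel) = \<infinity> \<and>
          (\<integral>\<^sup>+ r\<in>{0<..<a}. ennreal (r ^ (DIM('a) - 1) * v r) \<partial>lborel) < \<infinity>"
  shows "(\<exists>\<phi>. positive_solution DIM('a) R v w \<phi>) \<longleftrightarrow>
         (\<forall>u \<in> test_functions (ball0 R :: 'a set).
            (\<integral>\<^sup>+ x\<in>ball0 R. ennreal (V x * (norm (gradient u x))\<^sup>2) \<partial>lborel) \<ge>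
            (\<integral>\<^sup>+ x\<in>ball0 R. ennreal (W x * (u x)\<^sup>2) \<partial>lborel))"
proof -
  interpret radial_weights R V W v w by (rule radial_weights.intro) (fact assms)+
  obtain a where a: "a \<in> einterval 0 R" "(\<integral>\<^sup>+r\<in>{0<..<a}. ennreal (1 / P r) \<partial>lborel) = \<infinity>"
    using assms(4) by (auto simp: P_def einterval_iff)
  show ?thesis
  proof
    assume "\<exists>\<phi>. positive_solution DIM('a) R v w \<phi>"
    then obtain \<phi> z where sol: "solution \<phi> z" "\<And>r. r \<in> einterval 0 R \<Longrightarrow> 0 < \<phi> r"
      using solution_of_positive_solution by metis
    show "\<forall>u \<in> test_functions (ball0 R :: 'a set).
            (\<integral>\<^sup>+ x\<in>ball0 R. ennreal (V x * (norm (gradient u x))\<^sup>2) \<partial>lborel) \<ge>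
            (\<integral>\<^sup>+ x\<in>ball0 R. ennreal (W x * (u x)\<^sup>2) \<partial>lborel)"
      using hardy_inequality[OF sol solution_z_nonpos[OF refl sol a]] by blast
  next
    assume ineq: "\<forall>u \<in> test_functions (ball0 R :: 'a set).
            (\<integral>\<^sup>+ x\<in>ball0 R. ennreal (V x * (norm (gradient u x))\<^sup>2) \<partial>lborel) \<ge>
            (\<integral>\<^sup>+ x\<in>ball0 R. ennreal (W x * (u x)\<^sup>2) \<partial>lborel)"
    then have form: nonneg_form by (intro nonneg_form_of_inequality) blast
    have "\<exists>y z. solution y z \<and> (\<forall>r\<in>einterval 0 R. 0 < y r)"
      by (rule positive_solution_exists[OF R_pos]) (rule disconjugate[OF form])
    then obtain y z where sol: "solution y z" "\<And>r. r \<in> einterval 0 R \<Longrightarrow> 0 < y r"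
      by blast
    \<comment> \<open>The constructed solution is positive, so divergence of the integral of
      \<open>1 / P\<close> makes its flux nonpositive as well; here this supplies continuity at a
      finite \<open>R\<close>.\<close>
    show "\<exists>\<phi>. positive_solution DIM('a) R v w \<phi>"
      by (rule positive_solution_of_solution[OF sol solution_z_nonpos[OF refl sol a]])
  qed
qed

end
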